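(* For all $\epsilon\in(0,1/2)$, $\delta\in(0,1)$ and $d\in\mathbb{N}^+$, $$G^d_{\mathcal{U}\to\mathcal{C}}(\epsilon,\delta,n)\in\Omega(2^n/n)\quad\text{as } n\to\infty.$$
   Context: Let $\mathcal{B}=\{0,1\}$, let $\mathcal{B}^*$ be the set of finite binary strings and $|h|$ the length of $h\in\mathcal{B}^*$. For $n\in\mathbb{N}^+$, $H^n$ is the set of all functions $\mathcal{B}^n\to\mathcal{B}$ and $\Delta(\mathcal{B}^n)$ the set of probability distributions on $\mathcal{B}^n$. A learning problem is a pair $(f,\mathcal{P})$ with $f\in H^n$, $\mathcal{P}\in\Delta(\mathcal{B}^n)$; an $m$-sample dataset for it is the random sequence $[(x_j,f(x_j))]_{j=1}^m$ with $x_1,\dots,x_m$ i.i.d. $\sim\mathcal{P}$. The accuracy of $\hat f\in H^n$ is $\mathrm{acc}^{\mathcal{P}}_f(\hat f)=\Pr_{x\sim\mathcal{P}}[\hat f(x)=f(x)]$. For $\epsilon\in(0,1/2)$, $\delta\in(0,1)$, an algorithm $\mathcal{A}$ has an $(\epsilon,\delta)$-PAC-learning performance with an $m$-sample dataset on $(f,\mathcal{P})$ if for every $m'\ge m$, with probability at least $1-\delta$ over an $m'$-sample dataset $S$, $\mathrm{acc}^{\mathcal{P}}_f(\mathcal{A}(S))\ge 1-\epsilon$. An interpreter is a Turing machine computing a partial function $\varphi:\mathcal{B}^*\times\mathcal{B}^*\to\mathcal{B}\cup\{\bot\}$, where $\bot$ denotes non-halting (or invalid) output. For $f\in H^n$,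 $|f|_\varphi=\min\{|h|:\varphi(h,x)=f(x)\ \forall x\in\mathcal{B}^n\}$ ($+\infty$ if no such $h$). The learning algorithm $\mathit{MDL}^\varphi$, on a dataset $[(x_j,y_j)]_{j=1}^m$ with $x_j\in\mathcal{B}^n$, selects $h^*$ of minimal length among all $h$ with $\varphi(h,x_j)=y_j$ for all $j$ and $\varphi(h,x)\neq\bot$ for all $x\in\mathcal{B}^n$ (ties broken arbitrarily) and outputs $x\mapsto\varphi(h^*,x)$ on $\mathcal{B}^n$. $m^{\epsilon,\delta}_\varphi(f,\mathcal{P})$ is the least $m\in\mathbb{N}^+$ such that $\mathit{MDL}^\varphi$ has an $(\epsilon,\delta)$-PAC-learning performance with an $m$-sample dataset on $(f,\mathcal{P})$ ($+\infty$ if none). For interpreters $\varphi,\psi$ and $n,d\in\mathbb{N}^+$, the sample efficiency gain is $G^d_{\varphi\to\psi}(\epsilon,\delta,n)=\sup\{ m^{\epsilon,\delta}_\psi(f,\mathcal{P})/m^{\epsilon,\delta}_\varphi(f,\mathcal{P}) : f\in H^n,\ \mathcal{P}\in\Delta(\mathcal{B}^n),\ |f|_\varphi\le n^d\}$. Turing machines have alphabet $\{0,1,b\}$ ($b$ blank), a finite state set containing an initial state and two final states accept/reject; the output is $1$ if halting in accept, $0$ if halting in reject, $\bot$ otherwise; multi-tape machines have read-only input tapes and read/write work tapes, and the transition function is a finite list of rules. $E(T)$ is a fixed prefix-free binary encoding of a machine $T$ listing its rules. $\mathcal{U}$ is the universal interpreter: on $(p,x)$, if $p=E(T)u$ (concatenation)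 for a two-input-tape Turing machine $T$ (with a fixed number of work tapes) and $u\in\mathcal{B}^*$, it outputs $T(u,x)$; otherwise $\bot$. A Boolean circuit on $n$ inputs is a DAG with a unique sink (output) whose sources are labelled by input indices in $\{1,\dots,n\}$ and whose other vertices (gates) are labelled AND, OR (two incoming edges) or NOT (one incoming edge); its size $|C|$ is its number of vertices. The circuit interpreter $\mathcal{C}$ reads a program $h=0^{\lceil\log_2 n\rceil}1\,[\text{binary expansion of } n]\,0^{|C|}1\,[\text{description of vertex } i]_{i=1}^{|C|}$, each vertex being described by its label and its parents/input index using $\max\{2\lceil\log_2|C|\rceil,\lceil\log_2 n\rceil\}$ bits beyond the label bits, so a circuit $C$ on $n$ inputs has encoding length $L(|C|,n)=2\lceil\log_2 n\rceil+2+|C|(3+\max\{2\lceil\log_2|C|\rceil,\lceil\log_2 n\rceil\})$; $\mathcal{C}(h,x)$ is the circuit's output on $x\in\mathcal{B}^n$, and $\bot$ if $h$ is malformed. Hence $|f|_{\mathcal{C}}=\min\{L(|C|,n): C \text{ computes } f\}$. *)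

theory Defs
  imports "HOL-Probability.Probability_Mass_Function" "HOL-Library.Extended_Real"
begin

text \<open>An interpreter maps a program and an input (both binary strings) to an
  output in B or bottom (None).\<close>
type_synonym interp = "bool list \<Rightarrow> bool list \<Rightarrow> bool option"

datatype sym = S0 | S1 | Blank
datatype move = MoveL | MoveR | Stay

text \<open>A rule: current state, symbols read on all 2+k tapes (2 input tapes, then
  k work tapes), new state, symbols written on the k work tapes, head moves of all
  2+k heads.\<close>
datatype rule = Rule (r_state: nat) (r_read: "sym list") (r_next: nat)
                     (r_write: "sym list") (r_moves: "move list")

datatype tm = TM (tm_init: nat) (tm_acc: nat) (tm_rej: nat) (tm_rules: "rule list")

definition wf_tm :: "nat \<Rightarrow> tm \<Rightarrow> bool" where
  "wf_tm k T \<longleftrightarrow> tm_acc T \<noteq> tm_rej T \<and>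
     (\<forall>r\<in>set (tm_rules T). length (r_read r) = k + 2 \<and> length (r_write r) = k
        \<and> length (r_moves r) = k + 2 \<and> r_state r \<noteq> tm_acc T \<and> r_state r \<noteq> tm_rej T) \<and>
     distinct (map (\<lambda>r. (r_state r, r_read r)) (tm_rules T))"

definition tape_of :: "bool list \<Rightarrow> int \<Rightarrow> sym" where
  "tape_of u i = (if 0 \<le> i \<and> nat i < length u then (if u ! nat i then S1 else S0) else Blank)"

fun move_head :: "move \<Rightarrow> int \<Rightarrow> int" where
  "move_head MoveL h = h - 1"
| "move_head MoveR h = h + 1"
| "move_head Stay h = h"

text \<open>Configuration: state, head positions (2+k), work tape contents (k).\<close>
type_synonym config = "nat \<times> int list \<times> (int \<Rightarrow> sym) list"

definition read_syms :: "nat \<Rightarrow> bool list \<Rightarrow> bool list \<Rightarrow> config \<Rightarrow> sym list" where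
  "read_syms k u x c = (case c of (q, hs, ws) \<Rightarrow>
     [tape_of u (hs ! 0), tape_of x (hs ! 1)] @ map (\<lambda>i. (ws ! i) (hs ! (i + 2))) [0..<k])"

definition tm_step :: "nat \<Rightarrow> tm \<Rightarrow> bool list \<Rightarrow> bool list \<Rightarrow> config \<Rightarrow> config" where
  "tm_step k T u x c = (case c of (q, hs, ws) \<Rightarrow>
     if q = tm_acc T \<or> q = tm_rej T then c else
     (case find (\<lambda>r. r_state r = q \<and> r_read r = read_syms k u x c) (tm_rules T) of
        None \<Rightarrow> c
      | Some r \<Rightarrow> (r_next r,
                  map (\<lambda>i. move_head (r_moves r ! i) (hs ! i)) [0..<k + 2],
                  map (\<lambda>i. (ws ! i)(hs ! (i + 2) := r_write r ! i)) [0..<k])))"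

definition tm_init_conf :: "nat \<Rightarrow> tm \<Rightarrow> config" where
  "tm_init_conf k T = (tm_init T, replicate (k + 2) 0, replicate k (\<lambda>_. Blank))"

definition tm_run :: "nat \<Rightarrow> tm \<Rightarrow> bool list \<Rightarrow> bool list \<Rightarrow> nat \<Rightarrow> config" where
  "tm_run k T u x t = (tm_step k T u x ^^ t) (tm_init_conf k T)"

definition tm_out :: "nat \<Rightarrow> tm \<Rightarrow> bool list \<Rightarrow> bool list \<Rightarrow> bool option" where
  "tm_out k T u x =
     (if \<exists>t. fst (tm_run k T u x t) = tm_acc T then Some True
      else if \<exists>t. fst (tm_run k T u x t) = tm_rej T then Some False
      else None)"

definition prefix_free_enc :: "nat \<Rightarrow> (tm \<Rightarrow> bool list) \<Rightarrow> bool" where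
  "prefix_free_enc k E \<longleftrightarrow>
     (\<forall>T T' v. wf_tm k T \<and> wf_tm k T' \<and> E T' = E T @ v \<longrightarrow> T = T')"

definition univ :: "nat \<Rightarrow> (tm \<Rightarrow> bool list) \<Rightarrow> interp" where
  "univ k E p x =
     (if \<exists>T u. wf_tm k T \<and> p = E T @ u then
        (let Tu = (THE Tu. wf_tm k (fst Tu) \<and> p = E (fst Tu) @ snd Tu)
         in tm_out k (fst Tu) (snd Tu) x)
      else None)"

definition clog :: "nat \<Rightarrow> nat" where
  "clog n = (LEAST a. n \<le> 2 ^ a)"

definition bits_nat :: "bool list \<Rightarrow> nat" where
  "bits_nat bs = foldl (\<lambda>acc b. 2 * acc + (if b then 1 else 0)) 0 bs"

text \<open>Vertices listed in a topological order; parents are referred to by their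
  (0-based) position, input indices are 0-based (index j stands for input j+1).\<close>
datatype gate = Inp nat | NotG nat | AndG nat nat | OrG nat nat

definition valid_circ :: "nat \<Rightarrow> gate list \<Rightarrow> bool" where
  "valid_circ n gs \<longleftrightarrow> n \<ge> 1 \<and> gs \<noteq> [] \<and>
     (\<forall>i < length gs. case gs ! i of
         Inp j \<Rightarrow> j < n
       | NotG a \<Rightarrow> a < i
       | AndG a b \<Rightarrow> a < i \<and> b < i
       | OrG a b \<Rightarrow> a < i \<and> b < i) \<and>
     \<comment> \<open>unique sink: every vertex other than the last one has a child\<close>
     (\<forall>i < length gs - 1. \<exists>j < length gs. case gs ! j of
         Inp _ \<Rightarrow> False
       | NotG a \<Rightarrow> a = i
       | AndG a b \<Rightarrow> a = i \<or> b = i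
       | OrG a b \<Rightarrow> a = i \<or> b = i)"

fun gate_val :: "bool list \<Rightarrow> bool list \<Rightarrow> gate \<Rightarrow> bool" where
  "gate_val x vs (Inp j) = x ! j"
| "gate_val x vs (NotG a) = (\<not> vs ! a)"
| "gate_val x vs (AndG a b) = (vs ! a \<and> vs ! b)"
| "gate_val x vs (OrG a b) = (vs ! a \<or> vs ! b)"

definition circ_eval :: "gate list \<Rightarrow> bool list \<Rightarrow> bool" where
  "circ_eval gs x = last (foldl (\<lambda>vs g. vs @ [gate_val x vs g]) [] gs)"

definition decode_vertex :: "nat \<Rightarrow> nat \<Rightarrow> bool list \<Rightarrow> gate" where
  "decode_vertex n s d =
     (let p = drop 2 d; c = clog s in
      if \<not> d ! 0 \<and> \<not> d ! 1 then Inp (bits_nat (take (clog n) p))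
      else if \<not> d ! 0 \<and> d ! 1 then NotG (bits_nat (take c p))
      else if d ! 0 \<and> \<not> d ! 1 then AndG (bits_nat (take c p)) (bits_nat (take c (drop c p)))
      else OrG (bits_nat (take c p)) (bits_nat (take c (drop c p))))"

text \<open>Program format: 0^a 1 [n in a+1 bits] 0^(s-1) 1 [s vertex descriptions, each
  2 label bits + w further bits], a = clog n, w = max (2 clog s) (clog n).
  Its length is exactly L(s,n) = 2 clog n + 2 + s (3 + w).\<close>
definition circ_decode :: "bool list \<Rightarrow> (nat \<times> gate list) option" where
  "circ_decode h =
     (let a = length (takeWhile Not h) in
      if a \<ge> length h then None else
      let r1 = drop (a + 1) h in
      if length r1 < a + 1 then None else
      let n = bits_nat (take (a + 1) r1) in
      if n = 0 \<or> clog n \<noteq> a then None else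
      let r2 = drop (a + 1) r1; s' = length (takeWhile Not r2) in
      if s' \<ge> length r2 then None else
      let s = s' + 1; r3 = drop (s' + 1) r2; w = max (2 * clog s) (clog n) in
      if length r3 \<noteq> s * (2 + w) then None else
      Some (n, map (\<lambda>i. decode_vertex n s (take (2 + w) (drop (i * (2 + w)) r3))) [0..<s]))"

definition circ_interp :: interp where
  "circ_interp h x =
     (case circ_decode h of
        None \<Rightarrow> None
      | Some (n, gs) \<Rightarrow> if valid_circ n gs \<and> length x = n then Some (circ_eval gs x) else None)"

definition acc :: "bool list pmf \<Rightarrow> (bool list \<Rightarrow> bool) \<Rightarrow> (bool list \<Rightarrow> bool option) \<Rightarrow> real" where
  "acc P f g = measure_pmf.prob P {x. g x = Some (f x)}"

definition desc_len :: "interp \<Rightarrow> nat \<Rightarrow> (bool list \<Rightarrow> bool) \<Rightarrow> enat" where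
  "desc_len \<phi> n f =
     (if \<exists>h. \<forall>x. length x = n \<longrightarrow> \<phi> h x = Some (f x)
      then enat (LEAST l. \<exists>h. length h = l \<and> (\<forall>x. length x = n \<longrightarrow> \<phi> h x = Some (f x)))
      else \<infinity>)"

definition mdl_cands :: "interp \<Rightarrow> nat \<Rightarrow> (bool list \<times> bool) list \<Rightarrow> bool list set" where
  "mdl_cands \<phi> n S = {h. (\<forall>(x, y) \<in> set S. \<phi> h x = Some y) \<and>
                         (\<forall>x. length x = n \<longrightarrow> \<phi> h x \<noteq> None)}"

definition mdl_selector :: "interp \<Rightarrow> (nat \<Rightarrow> (bool list \<times> bool) list \<Rightarrow> bool list) \<Rightarrow> bool" where
  "mdl_selector \<phi> sel \<longleftrightarrow> (\<forall>n S. mdl_cands \<phi> n S \<noteq> {} \<longrightarrow>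
      sel n S \<in> mdl_cands \<phi> n S \<and> (\<forall>h \<in> mdl_cands \<phi> n S. length (sel n S) \<le> length h))"

definition labelled :: "(bool list \<Rightarrow> bool) \<Rightarrow> bool list list \<Rightarrow> (bool list \<times> bool) list" where
  "labelled f xs = map (\<lambda>x. (x, f x)) xs"

definition mdl_pac :: "interp \<Rightarrow> (nat \<Rightarrow> (bool list \<times> bool) list \<Rightarrow> bool list) \<Rightarrow> real \<Rightarrow> real
    \<Rightarrow> nat \<Rightarrow> (bool list \<Rightarrow> bool) \<Rightarrow> bool list pmf \<Rightarrow> nat \<Rightarrow> bool" where
  "mdl_pac \<phi> sel \<epsilon> \<delta> n f P m \<longleftrightarrow>
     (\<forall>m' \<ge> m. measure_pmf.prob (replicate_pmf m' P)
         {xs. acc P f (\<phi> (sel n (labelled f xs))) \<ge> 1 - \<epsilon>} \<ge> 1 - \<delta>)"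

definition mdl_samples :: "interp \<Rightarrow> (nat \<Rightarrow> (bool list \<times> bool) list \<Rightarrow> bool list) \<Rightarrow> real \<Rightarrow> real
    \<Rightarrow> nat \<Rightarrow> (bool list \<Rightarrow> bool) \<Rightarrow> bool list pmf \<Rightarrow> enat" where
  "mdl_samples \<phi> sel \<epsilon> \<delta> n f P =
     (if \<exists>m \<ge> 1. mdl_pac \<phi> sel \<epsilon> \<delta> n f P m
      then enat (LEAST m. m \<ge> 1 \<and> mdl_pac \<phi> sel \<epsilon> \<delta> n f P m) else \<infinity>)"

definition gain :: "interp \<Rightarrow> (nat \<Rightarrow> (bool list \<times> bool) list \<Rightarrow> bool list)
    \<Rightarrow> interp \<Rightarrow> (nat \<Rightarrow> (bool list \<times> bool) list \<Rightarrow> bool list)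
    \<Rightarrow> nat \<Rightarrow> real \<Rightarrow> real \<Rightarrow> nat \<Rightarrow> ereal" where
  "gain \<phi> sel\<phi> \<psi> sel\<psi> d \<epsilon> \<delta> n =
     Sup {ereal_of_enat (mdl_samples \<psi> sel\<psi> \<epsilon> \<delta> n f P) / ereal_of_enat (mdl_samples \<phi> sel\<phi> \<epsilon> \<delta> n f P)
          | f P. set_pmf P \<subseteq> {x. length x = n} \<and> desc_len \<phi> n f \<le> enat (n ^ d)}"

end

theory Submission
  imports Defs
begin

text \<open>Take the uniform distribution on the cube and let \<open>F\<^sub>n\<close> be the first truth table that agrees with every
  circuit of at most \<open>2 ^ n / (M n)\<close> gates on less than a fraction \<open>1/2 + 1/q \<le> 1 - \<epsilon>\<close> of the inputs;
  it exists for large \<open>n\<close> by counting. It is found by a bounded search, so one Turing machine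
  computes all \<open>F\<^sub>n\<close>; their description length is constant for the universal interpreter, and a
  union bound over short programs shows that constantly many samples suffice there. On the circuit side \<open>m\<close>
  samples can be memorised with \<open>10 m\<close> gates, so MDL outputs a circuit with at most \<open>10 m\<close> gates. As
  long as \<open>10 m \<le> 2 ^ n / (M n)\<close> its accuracy is below \<open>1 - \<epsilon>\<close>, whatever the samples and ties.\<close>

section \<open>Structured tape programs as Turing machines\<close>

text \<open>The rate 2^n / n rests on two estimates. For s < 2^n there are only 2^(O(n s)) wire
  tables with s gates against 2^(2^n) truth tables, so counting can exclude sizes up to a constant
  times 2^n / n. To match this, memorising must cost O(1) gates per sample; a disjunction of
  minterms would cost about n and lose that factor. Exact hardness would not do, because MDL only
  has to be accurate up to \<epsilon>. The target must be far from every small circuit. The fraction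
  of tables that agree with a fixed one on at least 1/2 + 1/q of the inputs is exponentially small
  in 2^n, and this outweighs the number of circuits. Counting alone yields no description, whereas
  the universal interpreter needs one string serving all n. Hardness is therefore stated by
  quantifiers over bounded numbers, which makes the target primitive recursive. The enormous running
  time is harmless, since interpreters carry no time bound. What remains is to realise primitive
  recursion in the concrete machine model, hence the small compiler.\<close>

text \<open>A control state is the stack of commands still to be run; every command step is one machine
  step, and only finitely many stacks (\<open>conts\<close>) are reachable from a given program.\<close>

datatype test = UNoMark | XSome | XOne | WOne

datatype tcmd = Act "sym option" move move move | Sq tcmd tcmd | Cond test tcmd tcmd | Wh test tcmd

text \<open>Machine states are natural numbers; countability lets \<open>to_nat\<close> number the
  command stacks.\<close>

instance test :: countable by countable_datatype
instance sym :: countable by countable_datatype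
instance move :: countable by countable_datatype
instance tcmd :: countable by countable_datatype

fun holds :: "test \<Rightarrow> sym \<Rightarrow> sym \<Rightarrow> sym \<Rightarrow> bool" where
  "holds UNoMark a b c = (a \<noteq> S1)"
| "holds XSome a b c = (b \<noteq> Blank)"
| "holds XOne a b c = (b = S1)"
| "holds WOne a b c = (c = S1)"

text \<open>Only the stack and the three scanned symbols (program, input, first work tape) enter,
  which is what a machine rule may depend on.\<close>

fun ctl :: "tcmd list \<Rightarrow> sym \<Rightarrow> sym \<Rightarrow> sym \<Rightarrow> tcmd list \<times> sym option \<times> move \<times> move \<times> move" where
  "ctl [] a b c = ([], None, Stay, Stay, Stay)"
| "ctl (Act wo mu mx mw # cs) a b c = (cs, wo, mu, mx, mw)"
| "ctl (Sq p q # cs) a b c = (p # q # cs, None, Stay, Stay, Stay)"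
| "ctl (Cond t p q # cs) a b c = ((if holds t a b c then p else q) # cs, None, Stay, Stay, Stay)"
| "ctl (Wh t p # cs) a b c = ((if holds t a b c then p # Wh t p # cs else cs), None, Stay, Stay, Stay)"

type_synonym tapes = "int \<times> int \<times> int \<times> (int \<Rightarrow> sym)"

fun apply_act :: "sym option \<times> move \<times> move \<times> move \<Rightarrow> tapes \<Rightarrow> tapes" where
  "apply_act (wo, mu, mx, mw) (hu, hx, hw, w) =
     (move_head mu hu, move_head mx hx, move_head mw hw,
      (case wo of None \<Rightarrow> w | Some a \<Rightarrow> w(hw := a)))"

fun mstep :: "bool list \<Rightarrow> bool list \<Rightarrow> tcmd list \<times> tapes \<Rightarrow> tcmd list \<times> tapes" where
  "mstep u x (cs, (hu, hx, hw, w)) =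
     (case ctl cs (tape_of u hu) (tape_of x hx) (w hw) of (cs', a) \<Rightarrow> (cs', apply_act a (hu, hx, hw, w)))"

text \<open>Quantifying over the stack \<open>cs\<close> below \<open>c\<close> makes the relation
  compose: sequences and loops run \<open>c\<close> on top of arbitrary continuations.\<close>

definition exec :: "bool list \<Rightarrow> bool list \<Rightarrow> tcmd \<Rightarrow> tapes \<Rightarrow> tapes \<Rightarrow> bool" where
  "exec u x c \<sigma> \<sigma>' \<longleftrightarrow> (\<forall>cs. \<exists>t. (mstep u x ^^ t) (c # cs, \<sigma>) = (cs, \<sigma>'))"

fun conts :: "tcmd \<Rightarrow> tcmd list \<Rightarrow> tcmd list set" where
  "conts (Act wo mu mx mw) cs = {Act wo mu mx mw # cs}"
| "conts (Sq p q) cs = {Sq p q # cs} \<union> conts p (q # cs) \<union> conts q cs"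
| "conts (Cond t p q) cs = {Cond t p q # cs} \<union> conts p cs \<union> conts q cs"
| "conts (Wh t p) cs = {Wh t p # cs} \<union> conts p (Wh t p # cs)"

lemma finite_conts: "finite (conts c cs)"
  by (induction c arbitrary: cs) auto

lemma Cons_in_conts: "c # cs \<in> conts c cs"
  by (cases c) auto

text \<open>The only exit from \<open>conts c cs\<close> is \<open>cs\<close>, the stack left when
  \<open>c\<close> is finished. With \<open>finite_conts\<close> this yields a finite state
  set.\<close>

lemma ctl_conts: "ds \<in> conts c cs \<Longrightarrow> fst (ctl ds a b d) \<in> insert cs (conts c cs)"
proof (induction c arbitrary: cs)
  case (Sq p q)
  then show ?case using Cons_in_conts[of p "q # cs"] Cons_in_conts[of q cs] by fastforce
next
  case (Cond t p q)
  then show ?case using Cons_in_conts[of p cs] Cons_in_conts[of q cs] by auto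
next
  case (Wh t p)
  then show ?case using Cons_in_conts[of p "Wh t p # cs"] by fastforce
qed auto

lemma exec_trans1:
  assumes "\<And>cs. mstep u x (c # cs, \<sigma>) = (ds @ cs, \<sigma>1)" and "\<And>cs. \<exists>t. (mstep u x ^^ t) (ds @ cs, \<sigma>1) = (cs, \<sigma>2)"
  shows "exec u x c \<sigma> \<sigma>2"
  unfolding exec_def
proof
  fix cs
  obtain t where "(mstep u x ^^ t) (ds @ cs, \<sigma>1) = (cs, \<sigma>2)" using assms(2) by blast
  then have "(mstep u x ^^ Suc t) (c # cs, \<sigma>) = (cs, \<sigma>2)" using assms(1) by (simp add: funpow_swap1)
  then show "\<exists>t. (mstep u x ^^ t) (c # cs, \<sigma>) = (cs, \<sigma>2)" by blast
qed

lemma exec_Act: "exec u x (Act wo mu mx mw) \<sigma> (apply_act (wo, mu, mx, mw) \<sigma>)"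
  by (cases \<sigma>, rule exec_trans1[where ds = "[]"]) (auto intro: exI[of _ 0])

lemma exec_append:
  assumes "exec u x p \<sigma> \<sigma>1" "exec u x q \<sigma>1 \<sigma>2"
  shows "\<exists>t. (mstep u x ^^ t) (p # q # cs, \<sigma>) = (cs, \<sigma>2)"
proof -
  obtain t1 where 1: "(mstep u x ^^ t1) (p # q # cs, \<sigma>) = (q # cs, \<sigma>1)" using assms(1) exec_def by blast
  obtain t2 where 2: "(mstep u x ^^ t2) (q # cs, \<sigma>1) = (cs, \<sigma>2)" using assms(2) exec_def by blast
  have "(mstep u x ^^ (t2 + t1)) (p # q # cs, \<sigma>) = (cs, \<sigma>2)" using 1 2 by (simp add: funpow_add)
  then show ?thesis by blast
qed

lemma exec_Sq:
  assumes "exec u x p \<sigma> \<sigma>1" "exec u x q \<sigma>1 \<sigma>2"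
  shows "exec u x (Sq p q) \<sigma> \<sigma>2"
  by (cases \<sigma>, rule exec_trans1[where ds = "[p, q]" and ?\<sigma>1.0 = \<sigma>])
     (use exec_append[OF assms] in auto)

lemma exec_Cond:
  assumes "exec u x (if holds t (tape_of u hu) (tape_of x hx) (w hw) then p else q) (hu, hx, hw, w) \<sigma>2"
  shows "exec u x (Cond t p q) (hu, hx, hw, w) \<sigma>2"
  by (rule exec_trans1[where ds = "[if holds t (tape_of u hu) (tape_of x hx) (w hw) then p else q]"
        and ?\<sigma>1.0 = "(hu, hx, hw, w)"]) (use assms in \<open>auto simp: exec_def\<close>)

lemma exec_Wh_False:
  assumes "\<not> holds t (tape_of u hu) (tape_of x hx) (w hw)"
  shows "exec u x (Wh t p) (hu, hx, hw, w) (hu, hx, hw, w)"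
  by (rule exec_trans1[where ds = "[]" and ?\<sigma>1.0 = "(hu, hx, hw, w)"]) (use assms in \<open>auto intro: exI[of _ 0]\<close>)

lemma exec_Wh_True:
  assumes "holds t (tape_of u hu) (tape_of x hx) (w hw)"
    and "exec u x p (hu, hx, hw, w) \<sigma>1" "exec u x (Wh t p) \<sigma>1 \<sigma>2"
  shows "exec u x (Wh t p) (hu, hx, hw, w) \<sigma>2"
  by (rule exec_trans1[where ds = "[p, Wh t p]" and ?\<sigma>1.0 = "(hu, hx, hw, w)"])
     (use assms exec_append[OF assms(2,3)] in auto)

section \<open>Translation of tape programs into rule lists\<close>

definition st_code :: "tcmd list \<Rightarrow> nat" where
  "st_code cs = Suc (Suc (to_nat cs))"

lemma st_code_eq_iff [simp]: "st_code cs = st_code ds \<longleftrightarrow> cs = ds"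
  by (simp add: st_code_def)

lemma st_code_neq [simp]: "0 < st_code cs" "st_code cs \<noteq> 0" "st_code cs \<noteq> Suc 0"
  by (simp_all add: st_code_def)

text \<open>The shift by two in \<open>st_code\<close> frees 0 and 1 for accept and reject; the
  empty stack goes to one of them according to the scanned work cell. The other \<open>k - 1\<close>
  work tapes get back the symbol just read and their heads stay.\<close>

definition mk_rule :: "nat \<Rightarrow> tcmd list \<times> sym list \<Rightarrow> rule" where
  "mk_rule k = (\<lambda>(cs, rd). case ctl cs (rd ! 0) (rd ! 1) (rd ! 2) of (cs', wo, mu, mx, mw) \<Rightarrow>
     Rule (st_code cs) rd
       (if cs = [] then (if rd ! 2 = S1 then 0 else 1) else st_code cs')
       ((case wo of None \<Rightarrow> rd ! 2 | Some a \<Rightarrow> a) # drop 3 rd)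
       ([mu, mx, mw] @ replicate (k - 1) Stay))"

definition reads :: "nat \<Rightarrow> sym list list" where
  "reads k = List.n_lists (k + 2) [S0, S1, Blank]"

lemma sym_cases3: "set [S0, S1, Blank] = UNIV"
  using sym.exhaust by auto

lemma set_reads: "set (reads k) = {rd. length rd = k + 2}"
  unfolding reads_def set_n_lists sym_cases3 by auto

text \<open>A rule for every stack and every tuple of symbols makes the table total; a distinct list
  of stacks gives the determinism that \<open>wf_tm\<close> demands.\<close>

definition mk_tm :: "nat \<Rightarrow> tcmd \<Rightarrow> tm" where
  "mk_tm k c = TM (st_code [c]) 0 1
     (map (mk_rule k) (List.product (SOME L. distinct L \<and> set L = insert [] (conts c [])) (reads k)))"

context
  fixes k :: nat and c :: tcmd
  assumes k1: "k \<ge> 1"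
begin

definition CS where "CS = (SOME L. distinct L \<and> set L = insert [] (conts c []))"

lemma CS: "distinct CS" "set CS = insert [] (conts c [])"
proof -
  have "\<exists>L. set L = insert [] (conts c []) \<and> distinct L"
    by (rule finite_distinct_list) (simp add: finite_conts)
  then have "\<exists>L. distinct L \<and> set L = insert [] (conts c [])" by blast
  from someI_ex[OF this] show "distinct CS" "set CS = insert [] (conts c [])" unfolding CS_def by auto
qed

lemma mk_tm_simps: "tm_init (mk_tm k c) = st_code [c]" "tm_acc (mk_tm k c) = 0" "tm_rej (mk_tm k c) = 1"
  "tm_rules (mk_tm k c) = map (mk_rule k) (List.product CS (reads k))"
  by (simp_all add: mk_tm_def CS_def)

lemma mk_rule_key: "r_state (mk_rule k (cs, rd)) = st_code cs" "r_read (mk_rule k (cs, rd)) = rd"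
  by (auto simp: mk_rule_def split: prod.split)

lemma mk_rule_lengths:
  "length rd = k + 2 \<Longrightarrow> length (r_write (mk_rule k (cs, rd))) = k"
  "length (r_moves (mk_rule k (cs, rd))) = k + 2"
  using k1 by (auto simp: mk_rule_def split: prod.split)

lemma wf_mk_tm: "wf_tm k (mk_tm k c)"
proof -
  have "distinct (map (\<lambda>r. (r_state r, r_read r)) (tm_rules (mk_tm k c)))"
    unfolding mk_tm_simps map_map
  proof (subst distinct_map, intro conjI)
    show "distinct (List.product CS (reads k))"
      using CS(1) distinct_n_lists[of "[S0, S1, Blank]" "k + 2"] by (intro distinct_product) (simp_all only: reads_def, simp)
    show "inj_on ((\<lambda>r. (r_state r, r_read r)) \<circ> mk_rule k) (set (List.product CS (reads k)))"
      by (auto simp: inj_on_def mk_rule_key)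
  qed
  moreover have "\<forall>r\<in>set (tm_rules (mk_tm k c)). length (r_read r) = k + 2 \<and> length (r_write r) = k
        \<and> length (r_moves r) = k + 2 \<and> r_state r \<noteq> 0 \<and> r_state r \<noteq> 1"
    by (auto simp: mk_tm_simps mk_rule_key mk_rule_lengths set_reads)
  ultimately show ?thesis by (simp add: wf_tm_def mk_tm_simps)
qed

lemma find_eq_Some_unique:
  "r \<in> set rs \<Longrightarrow> P r \<Longrightarrow> (\<And>r'. r' \<in> set rs \<Longrightarrow> P r' \<Longrightarrow> r' = r) \<Longrightarrow> find P rs = Some r"
proof (induction rs)
  case (Cons a rs)
  show ?case
  proof (cases "P a")
    case True
    then have "a = r" by (intro Cons.prems(3)) (simp_all only: list.set_intros)
    then show ?thesis using True by simp
  next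
    case False
    then have "r \<in> set rs" using Cons.prems(1,2) by auto
    then have "find P rs = Some r" by (rule Cons.IH[OF _ Cons.prems(2) Cons.prems(3)]) simp
    then show ?thesis using False by simp
  qed
qed simp

fun cfg :: "nat \<Rightarrow> tapes \<Rightarrow> config" where
  "cfg q (hu, hx, hw, w) = (q, [hu, hx, hw] @ replicate (k - 1) 0, w # replicate (k - 1) (\<lambda>_. Blank))"

text \<open>Every stack of the finite set has its rule, so machine and \<open>mstep\<close> move
  together except at the empty stack, where \<open>mstep\<close> idles and the machine
  halts.\<close>

lemma tm_step_cfg:
  assumes "cs \<in> insert [] (conts c [])"
  shows "tm_step k (mk_tm k c) u x (cfg (st_code cs) (hu, hx, hw, w)) =
    (case mstep u x (cs, (hu, hx, hw, w)) of (cs', \<sigma>) \<Rightarrow>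
      cfg (if cs = [] then (if w hw = S1 then 0 else 1) else st_code cs') \<sigma>)"
proof -
  define rd where "rd = read_syms k u x (cfg (st_code cs) (hu, hx, hw, w))"
  have len: "length rd = k + 2" by (simp add: rd_def read_syms_def)
  have rd012: "rd ! 0 = tape_of u hu" "rd ! Suc 0 = tape_of x hx" "rd ! 2 = w hw"
    using k1 by (auto simp: rd_def read_syms_def nth_append numeral_2_eq_2)
  \<comment> \<open>The idle work tapes read \<open>Blank\<close>, so writing back what was read
    keeps them blank.\<close>
  have rd3: "rd ! (i + 2) = (if i = 0 then w hw else Blank)" if "i < k" for i
    using that k1 by (cases i) (auto simp: rd_def read_syms_def nth_append)
  have find: "find (\<lambda>r. r_state r = st_code cs \<and> r_read r = rd) (tm_rules (mk_tm k c)) = Some (mk_rule k (cs, rd))"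
    by (rule find_eq_Some_unique) (use assms len CS in \<open>auto simp: mk_tm_simps set_reads mk_rule_key\<close>)
  obtain cs' wo mu mx mw where ctl: "ctl cs (tape_of u hu) (tape_of x hx) (w hw) = (cs', wo, mu, mx, mw)"
    by (metis prod_cases5)
  define r where "r = mk_rule k (cs, rd)"
  have r: "r = Rule (st_code cs) rd
       (if cs = [] then (if w hw = S1 then 0 else 1) else st_code cs')
       ((case wo of None \<Rightarrow> w hw | Some a \<Rightarrow> a) # drop 3 rd)
       ([mu, mx, mw] @ replicate (k - 1) Stay)"
    using ctl rd012 by (simp add: r_def mk_rule_def split: option.split)
  have wr: "map (\<lambda>i. ((w # replicate (k - 1) (\<lambda>_. Blank)) ! i)
        ((([hu, hx, hw] @ replicate (k - 1) 0) ! (i + 2)) := r_write r ! i)) [0..<k]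
      = (case wo of None \<Rightarrow> w | Some a \<Rightarrow> w(hw := a)) # replicate (k - 1) (\<lambda>_. Blank)" (is "?l = ?r")
  proof (rule nth_equalityI)
    show "length ?l = length ?r" using k1 by simp
    fix i assume "i < length ?l"
    then have i: "i < k" by simp
    show "?l ! i = ?r ! i"
    proof (cases i)
      case 0
      then show ?thesis using i by (auto simp: r split: option.split)
    next
      case (Suc j)
      have "drop 3 rd ! j = rd ! (3 + j)" using len i Suc by simp
      then have "drop 3 rd ! j = Blank" using rd3[OF i] Suc by (simp add: numeral_3_eq_3)
      then show ?thesis using i Suc by (auto simp: r)
    qed
  qed
  have mv: "map (\<lambda>i. move_head (r_moves r ! i) (([hu, hx, hw] @ replicate (k - 1) 0) ! i)) [0..<k + 2]
     = [move_head mu hu, move_head mx hx, move_head mw hw] @ replicate (k - 1) 0" (is "?l = ?r")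
  proof (rule nth_equalityI)
    show "length ?l = length ?r" using k1 by simp
    fix i assume "i < length ?l"
    then have i: "i < k + 2" by simp
    consider "i = 0" | "i = 1" | "i = 2" | j where "i = Suc (Suc (Suc j))"
      by (metis One_nat_def Suc_1 not0_implies_Suc)
    moreover have "?l ! i = move_head (r_moves r ! i) (([hu, hx, hw] @ replicate (k - 1) 0) ! i)"
      using i by (subst nth_map_upt) simp_all
    ultimately show "?l ! i = ?r ! i"
      using i by cases (simp_all add: r)
  qed
  have "tm_step k (mk_tm k c) u x (cfg (st_code cs) (hu, hx, hw, w)) =
     (r_next r, map (\<lambda>i. move_head (r_moves r ! i) (([hu, hx, hw] @ replicate (k - 1) 0) ! i)) [0..<k + 2],
      map (\<lambda>i. ((w # replicate (k - 1) (\<lambda>_. Blank)) ! i)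
        ((([hu, hx, hw] @ replicate (k - 1) 0) ! (i + 2)) := r_write r ! i)) [0..<k])"
  proof -
    have nf: "\<not> (st_code cs = tm_acc (mk_tm k c) \<or> st_code cs = tm_rej (mk_tm k c))"
      by (simp add: mk_tm_simps)
    show ?thesis
      unfolding tm_step_def cfg.simps prod.case if_not_P[OF nf] rd_def[unfolded cfg.simps, symmetric]
        find[folded r_def] option.case ..
  qed
  moreover have "r_next r = (if cs = [] then (if w hw = S1 then 0 else 1) else st_code cs')"
    by (simp add: r)
  ultimately show ?thesis
    unfolding wr mv mstep.simps ctl prod.case apply_act.simps cfg.simps by (simp only:)
qed

lemma mstep_simulation:
  assumes "(mstep u x ^^ t) (cs, \<sigma>) = ([], \<sigma>')" "cs \<in> insert [] (conts c [])"
  shows "\<exists>t'. (tm_step k (mk_tm k c) u x ^^ t') (cfg (st_code cs) \<sigma>) = cfg (st_code []) \<sigma>'"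
  using assms
proof (induction t arbitrary: cs \<sigma>)
  case 0
  then show ?case by (auto intro!: exI[of _ 0])
next
  case (Suc t)
  obtain hu hx hw w where \<sigma>: "\<sigma> = (hu, hx, hw, w)" by (metis prod_cases4)
  obtain cs1 \<sigma>1 where step: "mstep u x (cs, \<sigma>) = (cs1, \<sigma>1)"
    by (cases "mstep u x (cs, \<sigma>)")
  have rest: "(mstep u x ^^ t) (cs1, \<sigma>1) = ([], \<sigma>')"
    using Suc.prems(1) step by (simp add: funpow_swap1)
  show ?case
  proof (cases "cs = []")
    case True
    \<comment> \<open>\<open>mstep\<close> idles on the empty stack, so its step is matched by no
      machine step; a real one would already halt.\<close>
    have "mstep u x (cs, \<sigma>) = (cs, \<sigma>)" using True by (simp add: \<sigma>)
    then have "(mstep u x ^^ t) (cs, \<sigma>) = ([], \<sigma>')" using rest step by simp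
    from Suc.IH[OF this Suc.prems(2)] show ?thesis .
  next
    case False
    have "cs1 = fst (ctl cs (tape_of u hu) (tape_of x hx) (w hw))"
      using step by (auto simp: \<sigma> split: prod.splits)
    then have "cs1 \<in> insert [] (conts c [])" using ctl_conts[of cs c "[]"] Suc.prems(2) False by auto
    from Suc.IH[OF rest this] obtain t' where
      "(tm_step k (mk_tm k c) u x ^^ t') (cfg (st_code cs1) \<sigma>1) = cfg (st_code []) \<sigma>'" by blast
    moreover have "tm_step k (mk_tm k c) u x (cfg (st_code cs) \<sigma>) = cfg (st_code cs1) \<sigma>1"
      using tm_step_cfg[OF Suc.prems(2)] False step unfolding \<sigma> by simp
    ultimately have "(tm_step k (mk_tm k c) u x ^^ Suc t') (cfg (st_code cs) \<sigma>) = cfg (st_code []) \<sigma>'"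
      by (simp add: funpow_swap1)
    then show ?thesis by blast
  qed
qed

lemma tm_final_fixed:
  assumes "fst C = tm_acc T \<or> fst C = tm_rej T"
  shows "(tm_step k T u x ^^ t) C = C"
  by (induction t) (use assms in \<open>auto simp: tm_step_def split: prod.split\<close>)

lemma tm_out_mk_tm:
  assumes "exec u x c (0, 0, 0, \<lambda>_. Blank) (hu, hx, hw, w)"
  shows "tm_out k (mk_tm k c) u x = Some (w hw = S1)"
proof -
  let ?T = "mk_tm k c"
  obtain t where "(mstep u x ^^ t) ([c], 0, 0, 0, \<lambda>_. Blank) = ([], hu, hx, hw, w)"
    using assms unfolding exec_def by blast
  from mstep_simulation[OF this] obtain t' where
    t': "(tm_step k ?T u x ^^ t') (cfg (st_code [c]) (0, 0, 0, \<lambda>_. Blank)) = cfg (st_code []) (hu, hx, hw, w)"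
    using Cons_in_conts[of c "[]"] by auto
  have init: "tm_init_conf k ?T = cfg (st_code [c]) (0, 0, 0, \<lambda>_. Blank)"
  proof -
    obtain k' where "k = Suc k'" using k1 by (cases k) auto
    then have "replicate (k + 2) (0::int) = [0, 0, 0] @ replicate (k - 1) 0"
      "replicate k (\<lambda>_::int. Blank) = (\<lambda>_. Blank) # replicate (k - 1) (\<lambda>_. Blank)"
      by simp_all
    then show ?thesis by (simp only: tm_init_conf_def mk_tm_simps cfg.simps)
  qed
  \<comment> \<open>At time \<open>t'\<close> the machine is in \<open>st_code []\<close>; one
    further step enters a final state.\<close>
  have run: "fst (tm_run k ?T u x (Suc t')) = (if w hw = S1 then 0 else 1)"
    unfolding tm_run_def init using t' tm_step_cfg[of "[]" u x hu hx hw w] by simp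
  \<comment> \<open>\<open>tm_out\<close> accepts if some time shows the accepting state, so a
    rejecting run must exclude all other times. Final states persist, hence all final times
    agree.\<close>
  have stable: "fst (tm_run k ?T u x i) = fst (tm_run k ?T u x j)"
    if "fst (tm_run k ?T u x i) \<in> {0, 1}" "i \<le> j" for i j
  proof -
    have "tm_run k ?T u x j = (tm_step k ?T u x ^^ (j - i)) (tm_run k ?T u x i)"
      unfolding tm_run_def using that(2) by (metis funpow_add le_add_diff_inverse2 o_apply)
    also have "\<dots> = tm_run k ?T u x i"
      by (rule tm_final_fixed) (use that in \<open>auto simp: mk_tm_simps\<close>)
    finally show ?thesis by simp
  qed
  have agree: "fst (tm_run k ?T u x i) = fst (tm_run k ?T u x (Suc t'))" if "fst (tm_run k ?T u x i) \<in> {0, 1}" for i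
    using stable[OF that, of "Suc t'"] stable[of "Suc t'" i] run that by (cases "i \<le> Suc t'") auto
  show ?thesis
  proof (cases "w hw = S1")
    case True
    then show ?thesis using run by (auto simp: tm_out_def mk_tm_simps)
  next
    case False
    then have "fst (tm_run k ?T u x i) \<noteq> 0" for i
      using agree[of i] run by (metis insertI1 zero_neq_one)
    then show ?thesis using run False by (auto simp: tm_out_def mk_tm_simps)
  qed
qed

end

section \<open>Counter registers and recursive functions on a tape\<close>

text \<open>Register \<open>r < R\<close> is stored in unary in the work cells congruent to \<open>r\<close> modulo \<open>R\<close>. The program
  string is \<open>[True]\<close>, and its head moves in parallel with the work head, so reading \<open>S1\<close> there
  signals the origin.\<close>

definition wt :: "nat \<Rightarrow> (nat \<Rightarrow> nat) \<Rightarrow> int \<Rightarrow> sym" where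
  "wt R s p = (if 0 \<le> p \<and> nat p div R < s (nat p mod R) then S1 else Blank)"

definition conf :: "nat \<Rightarrow> int \<Rightarrow> (nat \<Rightarrow> nat) \<Rightarrow> tapes" where
  "conf R hx s = (0, hx, 0, wt R s)"

definition skip :: tcmd where "skip = Act None Stay Stay Stay"

primrec rights :: "nat \<Rightarrow> tcmd" where
  "rights 0 = skip"
| "rights (Suc n) = Sq (Act None MoveR Stay MoveR) (rights n)"

primrec lefts :: "nat \<Rightarrow> tcmd" where
  "lefts 0 = skip"
| "lefts (Suc n) = Sq (Act None MoveL Stay MoveL) (lefts n)"

definition rewind :: tcmd where
  "rewind = Wh UNoMark (Act None MoveL Stay MoveL)"

definition inc :: "nat \<Rightarrow> nat \<Rightarrow> tcmd" where
  "inc R r = Sq (rights r) (Sq (Wh WOne (rights R)) (Sq (Act (Some S1) Stay Stay Stay) rewind))"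

text \<open>The scan stops at the first empty cell of the register, so the last mark lies
  \<open>R\<close> cells to the left.\<close>

definition decr :: "nat \<Rightarrow> nat \<Rightarrow> tcmd" where
  "decr R r = Sq (rights r) (Sq (Wh WOne (rights R)) (Sq (lefts R) (Sq (Act (Some Blank) Stay Stay Stay) rewind)))"

text \<open>Cell \<open>r\<close> is the lowest cell of register \<open>r\<close>, so
  \<open>WOne\<close> there says that the register is nonzero. Bodies start and end at the origin,
  hence the rewinding.\<close>

definition loop :: "nat \<Rightarrow> nat \<Rightarrow> tcmd \<Rightarrow> tcmd" where
  "loop R r c = Sq (rights r) (Sq (Wh WOne (Sq rewind (Sq c (rights r)))) rewind)"

lemma exec_Act': "\<sigma>' = apply_act (wo, mu, mx, mw) \<sigma> \<Longrightarrow> exec u x (Act wo mu mx mw) \<sigma> \<sigma>'"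
  by (simp add: exec_Act)

lemma exec_skip: "exec u x skip \<sigma> \<sigma>"
  unfolding skip_def by (cases \<sigma>, rule exec_Act') simp

lemma exec_rights: "exec u x (rights n) (hu, hx, hw, w) (hu + int n, hx, hw + int n, w)"
proof (induction n arbitrary: hu hw)
  case (Suc n)
  show ?case unfolding rights.simps
    by (rule exec_Sq[OF exec_Act]) (use Suc[of "hu + 1" "hw + 1"] in \<open>simp add: add.assoc\<close>)
qed (simp add: exec_skip)

lemma exec_lefts: "exec u x (lefts n) (hu, hx, hw, w) (hu - int n, hx, hw - int n, w)"
proof (induction n arbitrary: hu hw)
  case (Suc n)
  show ?case unfolding lefts.simps
    by (rule exec_Sq[OF exec_Act]) (use Suc[of "hu - 1" "hw - 1"] in \<open>simp add: algebra_simps\<close>)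
qed (simp add: exec_skip)

lemma tape_of_mark: "tape_of [True] i = S1 \<longleftrightarrow> i = 0"
  by (auto simp: tape_of_def)

lemma exec_rewind: "exec [True] x rewind (int p, hx, int p, w) (0, hx, 0, w)"
proof (induction p)
  case 0
  show ?case unfolding rewind_def
    using exec_Wh_False[of UNoMark "[True]" 0 x hx w 0] by (simp add: tape_of_mark)
next
  case (Suc p)
  show ?case unfolding rewind_def
    by (rule exec_Wh_True[OF _ exec_Act]) (use Suc in \<open>auto simp: tape_of_mark rewind_def\<close>)
qed

lemma wt_at: "r < R \<Longrightarrow> wt R s (int (i * R + r)) = (if i < s r then S1 else Blank)"
  by (simp add: wt_def del: of_nat_add of_nat_mult)

text \<open>Division by \<open>R\<close> identifies nonnegative cells with pairs of block and
  register, which turns an equation between tapes into a pointwise condition on registers.\<close>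

lemma wt_upd:
  assumes "r < R"
  shows "(wt R s)(int (i * R + r) := a) = wt R s' \<longleftrightarrow>
    (\<forall>j. \<forall>r'<R. (if j = i \<and> r' = r then a else if j < s r' then S1 else Blank) = (if j < s' r' then S1 else Blank))"
proof
  assume L: "(wt R s)(int (i * R + r) := a) = wt R s'"
  show "\<forall>j. \<forall>r'<R. (if j = i \<and> r' = r then a else if j < s r' then S1 else Blank) = (if j < s' r' then S1 else Blank)"
  proof (intro allI impI)
    fix j r' assume r': "r' < R"
    have "(j * R + r' = i * R + r) = (j = i \<and> r' = r)"
      using assms r' by (metis div_mult_self3 mod_mult_self3 div_less mod_less add_0_right gr_implies_not0)
    then have eq: "(int (j * R + r') = int (i * R + r)) = (j = i \<and> r' = r)" by linarith
    have "((wt R s)(int (i * R + r) := a)) (int (j * R + r')) = wt R s' (int (j * R + r'))" using L by simp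
    then show "(if j = i \<and> r' = r then a else if j < s r' then S1 else Blank) = (if j < s' r' then S1 else Blank)"
      unfolding fun_upd_apply eq wt_at[OF r'] .
  qed
next
  assume *: "\<forall>j. \<forall>r'<R. (if j = i \<and> r' = r then a else if j < s r' then S1 else Blank) = (if j < s' r' then S1 else Blank)"
  show "(wt R s)(int (i * R + r) := a) = wt R s'"
  proof
    fix p :: int
    show "((wt R s)(int (i * R + r) := a)) p = wt R s' p"
    proof (cases "p < 0")
      case True
      then have "p \<noteq> int (i * R + r)" by linarith
      then show ?thesis using True by (simp add: wt_def)
    next
      case False
      define j r' where "j = nat p div R" and "r' = nat p mod R"
      have r': "r' < R" using assms by (simp add: r'_def)
      have "nat p = j * R + r'" by (simp add: j_def r'_def)
      then have p: "p = int (j * R + r')" using False by linarith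
      have "(j * R + r' = i * R + r) = (j = i \<and> r' = r)"
        using assms r' by (metis div_mult_self3 mod_mult_self3 div_less mod_less add_0_right gr_implies_not0)
      then have eq: "(int (j * R + r') = int (i * R + r)) = (j = i \<and> r' = r)" by linarith
      show ?thesis unfolding p fun_upd_apply eq wt_at[OF r'] using * r' by blast
    qed
  qed
qed

lemma exec_scan:
  assumes "r < R" "i \<le> s r"
  shows "exec u x (Wh WOne (rights R)) (int (i * R + r), hx, int (i * R + r), wt R s)
           (int (s r * R + r), hx, int (s r * R + r), wt R s)"
  using assms(2)
proof (induction rule: inc_induct)
  case base
  show ?case by (rule exec_Wh_False) (use wt_at[OF assms(1)] in simp)
next
  case (step i)
  have "int (i * R + r) + int R = int (Suc i * R + r)" by simp
  with exec_rights[of u x R "int (i * R + r)" hx "int (i * R + r)" "wt R s"]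
  have "exec u x (rights R) (int (i * R + r), hx, int (i * R + r), wt R s)
     (int (Suc i * R + r), hx, int (Suc i * R + r), wt R s)" by metis
  from exec_Wh_True[OF _ this step.IH] show ?case using wt_at[OF assms(1)] step by simp
qed

context
  fixes x :: "bool list" and hx :: int and R :: nat
begin

abbreviation rx :: "tcmd \<Rightarrow> (nat \<Rightarrow> nat) \<Rightarrow> (nat \<Rightarrow> nat) \<Rightarrow> bool" where
  "rx c s s' \<equiv> exec [True] x c (conf R hx s) (conf R hx s')"

lemma exec_rights_conf: "exec u x (rights n) (conf R hx s) (int n, hx, int n, wt R s)"
  using exec_rights[of u x n 0 hx 0 "wt R s"] by (simp add: conf_def)

lemma exec_seek:
  "r < R \<Longrightarrow> exec u x (Wh WOne (rights R)) (int r, hx, int r, wt R s) (int (s r * R + r), hx, int (s r * R + r), wt R s)"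
  using exec_scan[of r R 0 s] by simp

lemma rx_inc:
  assumes "r < R"
  shows "rx (inc R r) s (s(r := Suc (s r)))"
proof -
  have *: "(wt R s)(int (s r * R + r) := S1) = wt R (s(r := Suc (s r)))"
    unfolding wt_upd[OF assms] by auto
  have b: "exec [True] x (Sq (Act (Some S1) Stay Stay Stay) rewind)
     (int (s r * R + r), hx, int (s r * R + r), wt R s) (0, hx, 0, wt R (s(r := Suc (s r))))"
    by (rule exec_Sq[OF exec_Act]) (unfold apply_act.simps move_head.simps option.case *, rule exec_rewind)
  show ?thesis unfolding inc_def conf_def[of R hx "s(r := Suc (s r))"]
    by (rule exec_Sq[OF exec_rights_conf exec_Sq[OF exec_seek[OF assms] b]])
qed

lemma rx_decr:
  assumes "r < R" "s r > 0"
  shows "rx (decr R r) s (s(r := s r - 1))"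
proof -
  have *: "(wt R s)(int ((s r - 1) * R + r) := Blank) = wt R (s(r := s r - 1))"
    unfolding wt_upd[OF assms(1)] using assms(2) by auto
  have p: "int (s r * R + r) - int R = int ((s r - 1) * R + r)"
    using assms(2) by (cases "s r") simp_all
  have l: "exec [True] x (lefts R) (int (s r * R + r), hx, int (s r * R + r), wt R s)
      (int ((s r - 1) * R + r), hx, int ((s r - 1) * R + r), wt R s)"
    using exec_lefts[of "[True]" x R "int (s r * R + r)" hx "int (s r * R + r)" "wt R s"] unfolding p .
  have b: "exec [True] x (Sq (Act (Some Blank) Stay Stay Stay) rewind)
     (int ((s r - 1) * R + r), hx, int ((s r - 1) * R + r), wt R s) (0, hx, 0, wt R (s(r := s r - 1)))"
    by (rule exec_Sq[OF exec_Act]) (unfold apply_act.simps move_head.simps option.case *, rule exec_rewind)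
  show ?thesis unfolding decr_def conf_def[of R hx "s(r := s r - 1)"]
    by (rule exec_Sq[OF exec_rights_conf exec_Sq[OF exec_seek[OF assms(1)] exec_Sq[OF l b]]])
qed

text \<open>\<open>f i\<close> is the register state after \<open>i\<close> rounds; supplying the
  whole sequence settles invariant and termination at once.\<close>

lemma rx_loop:
  assumes r: "r < R"
    and body: "\<And>i. i < N \<Longrightarrow> rx c (f i) (f (Suc i))"
    and test: "\<And>i. i \<le> N \<Longrightarrow> f i r = 0 \<longleftrightarrow> i = N"
  shows "rx (loop R r c) (f 0) (f N)"
proof -
  let ?at = "\<lambda>i. (int r, hx, int r, wt R (f i))"
  have w: "wt R (f i) (int r) = S1 \<longleftrightarrow> f i r \<noteq> 0" for i using wt_at[OF r, of "f i" 0] by simp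
  have "exec [True] x (Wh WOne (Sq rewind (Sq c (rights r)))) (?at 0) (?at N)"
  proof (rule inc_induct[of 0 N "\<lambda>i. exec [True] x (Wh WOne (Sq rewind (Sq c (rights r)))) (?at i) (?at N)"])
    show "exec [True] x (Wh WOne (Sq rewind (Sq c (rights r)))) (?at N) (?at N)"
      by (rule exec_Wh_False) (use test[of N] w in simp)
  next
    fix i assume i: "0 \<le> i" "i < N"
      and IH: "exec [True] x (Wh WOne (Sq rewind (Sq c (rights r)))) (?at (Suc i)) (?at N)"
    have "exec [True] x rewind (?at i) (conf R hx (f i))" unfolding conf_def by (rule exec_rewind)
    from exec_Sq[OF this exec_Sq[OF body[OF i(2)] exec_rights_conf]]
    show "exec [True] x (Wh WOne (Sq rewind (Sq c (rights r)))) (?at i) (?at N)"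
      by (intro exec_Wh_True[OF _ _ IH]) (use test[of i] w i in simp_all)
  qed simp
  then show ?thesis unfolding loop_def conf_def[of R hx "f N"]
    by (intro exec_Sq[OF exec_rights_conf] exec_Sq[OF _ exec_rewind])
qed

definition clear :: "nat \<Rightarrow> tcmd" where "clear a = loop R a (decr R a)"
definition move :: "nat \<Rightarrow> nat \<Rightarrow> tcmd" where "move a b = loop R a (Sq (inc R b) (decr R a))"
text \<open>A loop reads a register by emptying it, so \<open>t\<close> collects a second copy that
  is moved back.\<close>

definition copy :: "nat \<Rightarrow> nat \<Rightarrow> nat \<Rightarrow> tcmd" where
  "copy a b t = Sq (loop R a (Sq (inc R t) (Sq (inc R b) (decr R a)))) (move t a)"

lemma rx_eq: "rx c s s1 \<Longrightarrow> s1 = s' \<Longrightarrow> rx c s s'"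
  by simp

lemma rx_eq2: "rx c s1 s2 \<Longrightarrow> s1 = s \<Longrightarrow> s2 = s' \<Longrightarrow> rx c s s'"
  by simp

lemma rx_clear: "a < R \<Longrightarrow> rx (clear a) s (s(a := 0))"
  unfolding clear_def
  using rx_loop[of a "s a" "decr R a" "\<lambda>i. s(a := s a - i)"]
  by (force intro: rx_eq[OF rx_decr])

lemma rx_move:
  assumes "a < R" "b < R" "a \<noteq> b"
  shows "rx (move a b) s (s(a := 0, b := s b + s a))"
proof -
  have "rx (move a b) (s(a := s a - 0, b := s b + 0)) (s(a := s a - s a, b := s b + s a))"
    unfolding move_def
  proof (rule rx_loop[of a "s a" _ "\<lambda>i. s(a := s a - i, b := s b + i)"])
    fix i assume "i < s a"
    then show "rx (Sq (inc R b) (decr R a)) (s(a := s a - i, b := s b + i)) (s(a := s a - Suc i, b := s b + Suc i))"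
      by (intro exec_Sq[OF rx_inc] rx_eq[OF rx_decr]) (use assms in auto)
  qed (use assms in auto)
  then show ?thesis by simp
qed

lemma rx_copy:
  assumes "a < R" "b < R" "t < R" "distinct [a, b, t]" "s t = 0"
  shows "rx (copy a b t) s (s(b := s b + s a))"
proof -
  have "rx (loop R a (Sq (inc R t) (Sq (inc R b) (decr R a))))
     (s(a := s a - 0, b := s b + 0, t := 0)) (s(a := s a - s a, b := s b + s a, t := s a))"
  proof (rule rx_loop[of a "s a" _ "\<lambda>i. s(a := s a - i, b := s b + i, t := i)"])
    fix i assume "i < s a"
    then show "rx (Sq (inc R t) (Sq (inc R b) (decr R a))) (s(a := s a - i, b := s b + i, t := i))
        (s(a := s a - Suc i, b := s b + Suc i, t := Suc i))"
      by (intro exec_Sq[OF rx_inc] rx_eq[OF rx_decr]) (use assms in auto)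
  qed (use assms in auto)
  from exec_Sq[OF this rx_move[OF assms(3,1)]] show ?thesis
    unfolding copy_def by (rule rx_eq2) (use assms in \<open>auto simp: fun_eq_iff\<close>)
qed

end

section \<open>Primitive recursive functions and their compilation to registers\<close>

text \<open>An environment assigns values to de Bruijn indices, \<open>case_nat v e\<close> being \<open>e\<close> extended by \<open>v\<close>.\<close>

inductive prec :: "((nat \<Rightarrow> nat) \<Rightarrow> nat) \<Rightarrow> bool" where
  prec_var: "prec (\<lambda>e. e i)"
| prec_zero: "prec (\<lambda>e. 0)"
| prec_Suc: "prec f \<Longrightarrow> prec (\<lambda>e. Suc (f e))"
| prec_let: "prec f \<Longrightarrow> prec g \<Longrightarrow> prec (\<lambda>e. g (case_nat (f e) e))"
| prec_drop: "prec f \<Longrightarrow> prec (\<lambda>e. f (\<lambda>i. e (Suc i)))"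
| prec_rec: "prec n \<Longrightarrow> prec b \<Longrightarrow> prec f \<Longrightarrow>
    prec (\<lambda>e. rec_nat (b e) (\<lambda>i a. f (case_nat a (case_nat i e))) (n e))"

text \<open>Registers above \<open>t\<close> serve as a stack of temporaries, hence must be zero before and after.\<close>

definition compiled :: "((nat \<Rightarrow> nat) \<Rightarrow> nat) \<Rightarrow> nat \<Rightarrow> (nat \<Rightarrow> nat) \<Rightarrow> nat \<Rightarrow> tcmd \<Rightarrow> bool" where
  "compiled f t \<rho> R c \<longleftrightarrow> (\<forall>x hx s. (\<forall>r\<ge>t. s r = 0) \<longrightarrow>
     exec [True] x c (conf R hx s) (conf R hx (s(t := f (\<lambda>i. s (\<rho> i))))))"

lemma compiledD:
  "compiled f t \<rho> R c \<Longrightarrow> (\<And>r. r \<ge> t \<Longrightarrow> s r = 0) \<Longrightarrow> s' = s(t := f (\<lambda>i. s (\<rho> i)))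
    \<Longrightarrow> exec [True] x c (conf R hx s) (conf R hx s')"
  by (simp add: compiled_def)

text \<open>The number \<open>m\<close> of scratch registers depends on the function alone.
  \<open>R\<close> is the stride of the tape layout and must be the same throughout a program, so
  code is produced for every large enough \<open>R\<close> and every placement \<open>\<rho>\<close>
  of the variables below \<open>t\<close>.\<close>

lemma prec_compiled:
  "prec f \<Longrightarrow> \<exists>m. \<forall>R t \<rho>. (\<forall>i. \<rho> i < t) \<longrightarrow> t + m \<le> R \<longrightarrow> (\<exists>c. compiled f t \<rho> R c)"
proof (induction rule: prec.induct)
  case (prec_var i)
  have "compiled (\<lambda>e. e i) t \<rho> R (copy R (\<rho> i) t (Suc t))" if "\<forall>i. \<rho> i < t" "t + 2 \<le> R" for R t \<rho>
    unfolding compiled_def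
  proof (intro allI impI)
    fix x hx and s :: "nat \<Rightarrow> nat" assume s: "\<forall>r\<ge>t. s r = 0"
    show "exec [True] x (copy R (\<rho> i) t (Suc t)) (conf R hx s) (conf R hx (s(t := s (\<rho> i))))"
      by (rule rx_eq[OF rx_copy]) (use that s in \<open>auto simp: less_imp_neq less_trans less_Suc_eq dest: spec[of _ i] intro: less_trans\<close>)
  qed
  then show ?case by blast
next
  case prec_zero
  have "compiled (\<lambda>e. 0) t \<rho> R skip" for R t \<rho>
    unfolding compiled_def by (auto intro!: rx_eq[OF exec_skip])
  then show ?case by blast
next
  case (prec_Suc f)
  then obtain m where m: "\<forall>R t \<rho>. (\<forall>i. \<rho> i < t) \<longrightarrow> t + m \<le> R \<longrightarrow> (\<exists>c. compiled f t \<rho> R c)" by blast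
  have "\<exists>c. compiled (\<lambda>e. Suc (f e)) t \<rho> R c" if \<rho>: "\<forall>i. \<rho> i < t" and R: "t + (m + 1) \<le> R" for R t \<rho>
  proof -
    obtain c where c: "compiled f t \<rho> R c" using m \<rho> R by (metis add_leD1 add.assoc)
    have "compiled (\<lambda>e. Suc (f e)) t \<rho> R (Sq c (inc R t))"
      unfolding compiled_def
      by (intro allI impI exec_Sq[OF compiledD[OF c _ refl]] rx_eq[OF rx_inc]) (use R in auto)
    then show ?thesis by blast
  qed
  then show ?case by blast
next
  case (prec_let f g)
  obtain m1 where m1: "\<forall>R t \<rho>. (\<forall>i. \<rho> i < t) \<longrightarrow> t + m1 \<le> R \<longrightarrow> (\<exists>c. compiled f t \<rho> R c)" using prec_let by blast
  obtain m2 where m2: "\<forall>R t \<rho>. (\<forall>i. \<rho> i < t) \<longrightarrow> t + m2 \<le> R \<longrightarrow> (\<exists>c. compiled g t \<rho> R c)" using prec_let by blast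
  have "\<exists>c. compiled (\<lambda>e. g (case_nat (f e) e)) t \<rho> R c" if \<rho>: "\<forall>i. \<rho> i < t" and R: "t + (m1 + m2 + 2) \<le> R" for R t \<rho>
  proof -
    have "t + m1 \<le> R" "Suc t + m2 \<le> R" using R by auto
    moreover have "\<forall>i. case_nat t \<rho> i < Suc t" using \<rho> by (auto split: nat.split simp: less_SucI)
    ultimately obtain c1 c2 where c1: "compiled f t \<rho> R c1" and c2: "compiled g (Suc t) (case_nat t \<rho>) R c2"
      using m1 m2 \<rho> by blast
    \<comment> \<open>The value of \<open>f\<close> sits in \<open>t\<close>, which
      \<open>case_nat t \<rho>\<close> makes variable 0 of \<open>g\<close>; the value of
      \<open>g\<close> in \<open>t + 1\<close> finally replaces it.\<close>
    have "compiled (\<lambda>e. g (case_nat (f e) e)) t \<rho> R (Sq c1 (Sq c2 (Sq (clear R t) (move R (Suc t) t))))"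
      unfolding compiled_def
    proof (intro allI impI)
      fix x hx and s :: "nat \<Rightarrow> nat" assume s: "\<forall>r\<ge>t. s r = 0"
      define v where "v = f (\<lambda>i. s (\<rho> i))"
      define w where "w = g (case_nat v (\<lambda>i. s (\<rho> i)))"
      have env: "(\<lambda>i. (s(t := v)) (case_nat t \<rho> i)) = case_nat v (\<lambda>i. s (\<rho> i))"
        using \<rho> by (auto simp: fun_eq_iff less_imp_neq split: nat.split)
      have 1: "rx x hx R c1 s (s(t := v))" by (rule compiledD[OF c1]) (use s in \<open>auto simp: v_def\<close>)
      have 2: "rx x hx R c2 (s(t := v)) (s(t := v, Suc t := w))"
        by (rule compiledD[OF c2]) (use s env in \<open>auto simp: w_def\<close>)
      have 3: "rx x hx R (clear R t) (s(t := v, Suc t := w)) (s(t := 0, Suc t := w))"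
        by (rule rx_eq[OF rx_clear]) (use R in auto)
      have 4: "rx x hx R (move R (Suc t) t) (s(t := 0, Suc t := w)) (s(t := w))"
        by (rule rx_eq[OF rx_move]) (use R s in auto)
      show "rx x hx R (Sq c1 (Sq c2 (Sq (clear R t) (move R (Suc t) t)))) s
          (s(t := g (case_nat (f (\<lambda>i. s (\<rho> i))) (\<lambda>i. s (\<rho> i)))))"
        using exec_Sq[OF 1 exec_Sq[OF 2 exec_Sq[OF 3 4]]] unfolding w_def v_def .
    qed
    then show ?thesis by blast
  qed
  then show ?case by blast
next
  case (prec_drop f)
  then obtain m where m: "\<forall>R t \<rho>. (\<forall>i. \<rho> i < t) \<longrightarrow> t + m \<le> R \<longrightarrow> (\<exists>c. compiled f t \<rho> R c)" by blast
  have "\<exists>c. compiled (\<lambda>e. f (\<lambda>i. e (Suc i))) t \<rho> R c" if \<rho>: "\<forall>i. \<rho> i < t" and R: "t + m \<le> R" for R t \<rho>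
  proof -
    have "\<exists>c. compiled f t (\<lambda>i. \<rho> (Suc i)) R c" by (rule m[rule_format]) (use \<rho> R in auto)
    then obtain c where "compiled f t (\<lambda>i. \<rho> (Suc i)) R c" ..
    then show ?thesis unfolding compiled_def by blast
  qed
  then show ?case by blast
next
  case (prec_rec n b f)
  obtain m1 where m1: "\<forall>R t \<rho>. (\<forall>i. \<rho> i < t) \<longrightarrow> t + m1 \<le> R \<longrightarrow> (\<exists>c. compiled n t \<rho> R c)" using prec_rec by blast
  obtain m2 where m2: "\<forall>R t \<rho>. (\<forall>i. \<rho> i < t) \<longrightarrow> t + m2 \<le> R \<longrightarrow> (\<exists>c. compiled b t \<rho> R c)" using prec_rec by blast
  obtain m3 where m3: "\<forall>R t \<rho>. (\<forall>i. \<rho> i < t) \<longrightarrow> t + m3 \<le> R \<longrightarrow> (\<exists>c. compiled f t \<rho> R c)" using prec_rec by blast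
  have "\<exists>c. compiled (\<lambda>e. rec_nat (b e) (\<lambda>i a. f (case_nat a (case_nat i e))) (n e)) t \<rho> R c"
    if \<rho>: "\<forall>i. \<rho> i < t" and R: "t + (m1 + m2 + m3 + 4) \<le> R" for R t \<rho>
  proof -
    have "t + m1 \<le> R" "t + 2 + m2 \<le> R" "t + 3 + m3 \<le> R" using R by auto
    moreover have "\<forall>i. \<rho> i < t + 2" "\<forall>i. case_nat (t + 2) (case_nat (t + 1) \<rho>) i < t + 3"
      using \<rho> by (auto split: nat.split intro!: less_SucI simp: numeral_2_eq_2 numeral_3_eq_3)
    ultimately have "\<exists>c. compiled n t \<rho> R c" "\<exists>c. compiled b (t + 2) \<rho> R c"
      "\<exists>c. compiled f (t + 3) (case_nat (t + 2) (case_nat (t + 1) \<rho>)) R c"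
      using \<rho> m1[rule_format] m2[rule_format] m3[rule_format] by presburger+
    then obtain c1 c2 c3 where c1: "compiled n t \<rho> R c1" and c2: "compiled b (t + 2) \<rho> R c2"
      and c3: "compiled f (t + 3) (case_nat (t + 2) (case_nat (t + 1) \<rho>)) R c3"
      by blast
    \<comment> \<open>Register \<open>t\<close> counts down, \<open>t + 1\<close> holds the round
      and \<open>t + 2\<close> the accumulator. The new value goes to \<open>t + 3\<close> because
      \<open>f\<close> still reads the old one.\<close>
    define body where "body = Sq c3 (Sq (clear R (t + 2)) (Sq (move R (t + 3) (t + 2)) (Sq (inc R (t + 1)) (decr R t))))"
    define prog where "prog = Sq c1 (Sq c2 (Sq (loop R t body) (Sq (clear R (t + 1)) (move R (t + 2) t))))"
    have "compiled (\<lambda>e. rec_nat (b e) (\<lambda>i a. f (case_nat a (case_nat i e))) (n e)) t \<rho> R prog"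
      unfolding compiled_def
    proof (intro allI impI)
      fix x hx and s :: "nat \<Rightarrow> nat" assume s: "\<forall>r\<ge>t. s r = 0"
      define e where "e = (\<lambda>i. s (\<rho> i))"
      define N where "N = n e"
      define A where "A = rec_nat (b e) (\<lambda>i a. f (case_nat a (case_nat i e)))"
      define F where "F = (\<lambda>i. s(t := N - i, t + 1 := i, t + 2 := A i))"
      have \<rho>': "\<rho> i \<noteq> t" "\<rho> i \<noteq> Suc t" "\<rho> i \<noteq> Suc (Suc t)" "\<rho> i \<noteq> Suc (Suc (Suc t))" for i
        using \<rho>[rule_format, of i] by auto
      have 1: "rx x hx R c1 s (s(t := N))"
        by (rule compiledD[OF c1]) (use s in \<open>auto simp: N_def e_def\<close>)
      have "(\<lambda>i. (s(t := N)) (\<rho> i)) = e" using \<rho>' by (auto simp: e_def)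
      then have 2: "rx x hx R c2 (s(t := N)) (F 0)"
        by (intro compiledD[OF c2]) (use s in \<open>auto simp: F_def A_def fun_eq_iff\<close>)
      have 3: "rx x hx R (loop R t body) (F 0) (F N)"
      proof (rule rx_loop)
        show "t < R" using R by simp
        show "(F i t = 0) = (i = N)" if "i \<le> N" for i using that by (auto simp: F_def)
        fix i assume i: "i < N"
        have env: "(\<lambda>j. F i (case_nat (t + 2) (case_nat (t + 1) \<rho>) j)) = case_nat (A i) (case_nat i e)"
          using \<rho>' by (auto simp: F_def e_def fun_eq_iff split: nat.split)
        have a: "rx x hx R c3 (F i) ((F i)(t + 3 := A (Suc i)))"
          by (rule compiledD[OF c3]) (use s env in \<open>auto simp: F_def A_def\<close>)
        have b: "rx x hx R (clear R (t + 2)) ((F i)(t + 3 := A (Suc i))) ((F i)(t + 3 := A (Suc i), t + 2 := 0))"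
          by (rule rx_clear) (use R in auto)
        have c: "rx x hx R (move R (t + 3) (t + 2)) ((F i)(t + 3 := A (Suc i), t + 2 := 0)) ((F i)(t + 2 := A (Suc i)))"
          by (rule rx_eq[OF rx_move]) (use R s in \<open>auto simp: F_def fun_eq_iff\<close>)
        have d: "rx x hx R (inc R (t + 1)) ((F i)(t + 2 := A (Suc i))) ((F i)(t + 2 := A (Suc i), t + 1 := Suc i))"
          by (rule rx_eq[OF rx_inc]) (use R s in \<open>auto simp: F_def fun_eq_iff\<close>)
        have e: "rx x hx R (decr R t) ((F i)(t + 2 := A (Suc i), t + 1 := Suc i)) (F (Suc i))"
          by (rule rx_eq[OF rx_decr]) (use R s i in \<open>auto simp: F_def fun_eq_iff\<close>)
        show "rx x hx R body (F i) (F (Suc i))"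
          unfolding body_def by (rule exec_Sq[OF a exec_Sq[OF b exec_Sq[OF c exec_Sq[OF d e]]]])
      qed
      have 4: "rx x hx R (clear R (t + 1)) (F N) ((F N)(t + 1 := 0))"
        by (rule rx_clear) (use R in auto)
      have 5: "rx x hx R (move R (t + 2) t) ((F N)(t + 1 := 0)) (s(t := A N))"
        by (rule rx_eq[OF rx_move]) (use R s in \<open>auto simp: F_def fun_eq_iff\<close>)
      show "rx x hx R prog s (s(t := rec_nat (b (\<lambda>i. s (\<rho> i)))
          (\<lambda>i a. f (case_nat a (case_nat i (\<lambda>i. s (\<rho> i))))) (n (\<lambda>i. s (\<rho> i)))))"
        using exec_Sq[OF 1 exec_Sq[OF 2 exec_Sq[OF 3 exec_Sq[OF 4 5]]]]
        unfolding prog_def A_def N_def e_def .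
    qed
    then show ?thesis by blast
  qed
  then show ?case by blast
qed

text \<open>Horner's rule: register 0 is doubled through register 2 and receives the next bit, while
  register 1 counts. The length is kept because the number forgets leading zeros.\<close>

definition read_input :: "nat \<Rightarrow> tcmd" where
  "read_input R = Wh XSome (Sq (loop R 0 (Sq (inc R 2) (Sq (inc R 2) (decr R 0)))) (Sq (move R 2 0)
     (Sq (Cond XOne (inc R 0) skip) (Sq (inc R 1) (Act None Stay MoveR Stay)))))"

lemma bits_nat_snoc: "bits_nat (bs @ [b]) = 2 * bits_nat bs + (if b then 1 else 0)"
  by (simp add: bits_nat_def)

lemma exec_read_input:
  assumes "R > 2"
  shows "exec [True] x (read_input R) (conf R 0 (\<lambda>_. 0))
     (conf R (int (length x)) ((\<lambda>_. 0)(0 := bits_nat x, 1 := length x)))"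
proof -
  define F where "F = (\<lambda>i. conf R (int i) ((\<lambda>_. 0)(0 := bits_nat (take i x), 1 := i)))"
  have "exec [True] x (read_input R) (F 0) (F (length x))"
  proof (rule inc_induct[of 0 "length x" "\<lambda>i. exec [True] x (read_input R) (F i) (F (length x))"])
    show "exec [True] x (read_input R) (F (length x)) (F (length x))"
      unfolding read_input_def F_def conf_def by (rule exec_Wh_False) (simp add: tape_of_def)
  next
    fix i assume i: "0 \<le> i" "i < length x" and IH: "exec [True] x (read_input R) (F (Suc i)) (F (length x))"
    let ?v = "bits_nat (take i x)"
    let ?b = "if x ! i then 1 else 0 :: nat"
    let ?st = "\<lambda>v n. (\<lambda>_. 0::nat)(0 := v, 1 := n::nat)"
    have "rx x (int i) R (loop R 0 (Sq (inc R 2) (Sq (inc R 2) (decr R 0)))) ((\<lambda>_. 0)(0 := ?v - 0, 1 := i, 2 := 2 * 0))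
       ((\<lambda>_. 0)(0 := ?v - ?v, 1 := i, 2 := 2 * ?v))"
    proof (rule rx_loop[of 0 R ?v _ _ _ "\<lambda>j. (\<lambda>_. 0)(0 := ?v - j, 1 := i, 2 := 2 * j)"])
      fix j assume j: "j < ?v"
      show "rx x (int i) R (Sq (inc R 2) (Sq (inc R 2) (decr R 0))) ((\<lambda>_. 0)(0 := ?v - j, 1 := i, 2 := 2 * j))
           ((\<lambda>_. 0)(0 := ?v - Suc j, 1 := i, 2 := 2 * Suc j))"
        by (intro exec_Sq[OF rx_inc] rx_eq[OF rx_decr]) (use assms j in \<open>auto simp: fun_eq_iff\<close>)
    qed (use assms in auto)
    then have 1: "rx x (int i) R (loop R 0 (Sq (inc R 2) (Sq (inc R 2) (decr R 0)))) (?st ?v i)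
       ((\<lambda>_. 0)(0 := ?v - ?v, 1 := i, 2 := 2 * ?v))" by (rule rx_eq2) (auto simp: fun_eq_iff)
    have 2: "rx x (int i) R (move R 2 0) ((\<lambda>_. 0)(0 := ?v - ?v, 1 := i, 2 := 2 * ?v)) (?st (2 * ?v) i)"
      by (rule rx_eq[OF rx_move]) (use assms in \<open>auto simp: fun_eq_iff\<close>)
    have "rx x (int i) R (if x ! i then inc R 0 else skip) (?st (2 * ?v) i) (?st (2 * ?v + ?b) i)"
    proof (cases "x ! i")
      case True
      then show ?thesis by simp (rule rx_eq[OF rx_inc], use assms in \<open>auto simp: fun_eq_iff\<close>)
    qed (simp add: exec_skip)
    moreover have "holds XOne a (tape_of x (int i)) c = (x ! i)" for a c
      using i by (simp add: tape_of_def)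
    ultimately have 3: "rx x (int i) R (Cond XOne (inc R 0) skip) (?st (2 * ?v) i) (?st (2 * ?v + ?b) i)"
      unfolding conf_def by (intro exec_Cond) (simp only:)
    have 4: "rx x (int i) R (inc R 1) (?st (2 * ?v + ?b) i) (?st (2 * ?v + ?b) (Suc i))"
      by (rule rx_eq[OF rx_inc]) (use assms in \<open>auto simp: fun_eq_iff\<close>)
    have 5: "exec [True] x (Act None Stay MoveR Stay) (conf R (int i) (?st (2 * ?v + ?b) (Suc i))) (F (Suc i))"
      by (rule exec_Act') (use i in \<open>simp add: conf_def F_def bits_nat_snoc take_Suc_conv_app_nth\<close>)
    note * = exec_Sq[OF 1 exec_Sq[OF 2 exec_Sq[OF 3 exec_Sq[OF 4 5]]]]
    show "exec [True] x (read_input R) (F i) (F (length x))"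
      using exec_Wh_True[OF _ *[unfolded conf_def[of R "int i"]] IH[unfolded read_input_def]] i
      by (simp add: read_input_def F_def[of] conf_def tape_of_def)
  qed simp
  moreover have "F 0 = conf R 0 (\<lambda>_. 0)"
    unfolding F_def by (rule arg_cong2[where f = "conf R"]) (auto simp: bits_nat_def fun_eq_iff)
  ultimately show ?thesis by (simp add: F_def)
qed

lemma prec_tm:
  assumes "prec f" "k \<ge> 1"
  shows "\<exists>T. wf_tm k T \<and> (\<forall>x. tm_out k T [True] x = Some (f (\<lambda>i. if i = 0 then bits_nat x else length x) > 0))"
proof -
  obtain m where m: "\<And>R t \<rho>. (\<forall>i. \<rho> i < t) \<Longrightarrow> t + m \<le> R \<Longrightarrow> \<exists>c. compiled f t \<rho> R c"
    using prec_compiled[OF assms(1)] by blast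
  \<comment> \<open>Registers 0 and 1 hold number and length, the result goes to 2; this
    \<open>R\<close> leaves room for \<open>2 + m\<close> registers and for
    \<open>read_input\<close>.\<close>
  define R where "R = m + 3"
  have "\<forall>i. (\<lambda>i. if i = 0 then 0 else 1 :: nat) i < 2" by simp
  from m[OF this, of R] obtain c where c: "compiled f 2 (\<lambda>i. if i = 0 then 0 else 1) R c" by (auto simp: R_def)
  \<comment> \<open>\<open>rights 2\<close> ends on the lowest cell of register 2, which is marked
    iff the result is positive; that cell decides acceptance.\<close>
  define prog where "prog = Sq (read_input R) (Sq c (rights 2))"
  have "tm_out k (mk_tm k prog) [True] x = Some (f (\<lambda>i. if i = 0 then bits_nat x else length x) > 0)" for x
  proof -
    define s :: "nat \<Rightarrow> nat" where "s = (\<lambda>_. 0)(0 := bits_nat x, 1 := length x)"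
    define v where "v = f (\<lambda>i. if i = 0 then bits_nat x else length x)"
    have env: "(\<lambda>i. s (if i = 0 then 0 else 1)) = (\<lambda>i. if i = (0::nat) then bits_nat x else length x)"
      by (simp add: s_def fun_eq_iff)
    have 1: "exec [True] x (read_input R) (conf R 0 (\<lambda>_. 0)) (conf R (int (length x)) s)"
      unfolding s_def by (rule exec_read_input) (simp add: R_def)
    have 2: "exec [True] x c (conf R (int (length x)) s) (conf R (int (length x)) (s(2 := v)))"
    proof (rule compiledD[OF c])
      show "s r = 0" if "r \<ge> 2" for r using that by (simp add: s_def)
      show "s(2 := v) = s(2 := f (\<lambda>i. s (if i = 0 then 0 else 1)))" unfolding env v_def ..
    qed
    have "wt R (\<lambda>_. 0) = (\<lambda>_. Blank)" by (simp add: wt_def fun_eq_iff)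
    with exec_Sq[OF 1 exec_Sq[OF 2 exec_rights_conf[of _ _ 2]]]
    have "exec [True] x prog (0, 0, 0, \<lambda>_. Blank) (int 2, int (length x), int 2, wt R (s(2 := v)))"
      unfolding prog_def by (simp add: conf_def)
    from tm_out_mk_tm[OF assms(2) this] show ?thesis
      using wt_at[of 2 R "s(2 := v)" 0] by (simp add: v_def R_def)
  qed
  then show ?thesis using wf_mk_tm[OF assms(2)] by blast
qed

section \<open>A bounded search for a hard truth table\<close>

abbreviation pd :: "((nat \<Rightarrow> nat) \<Rightarrow> bool) \<Rightarrow> bool" where
  "pd P \<equiv> prec (\<lambda>e. of_bool (P e))"

lemma prec_comp1:
  assumes "prec (\<lambda>e. F (e 0))" "prec a"
  shows "prec (\<lambda>e. F (a e))"
  using prec_let[OF assms(2,1)] by simp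

text \<open>Closure proofs may thus treat the arguments as variables 0 and 1. \<open>b\<close> is
  bound before \<open>a\<close>, and \<open>prec_drop\<close> hides that binding from
  \<open>a\<close>.\<close>

lemma prec_comp2:
  assumes "prec (\<lambda>e. F (e 0) (e (Suc 0)))" "prec a" "prec b"
  shows "prec (\<lambda>e. F (a e) (b e))"
  using prec_let[OF assms(3) prec_let[OF prec_drop[OF assms(2)] assms(1)]] by simp

lemma prec_const: "prec (\<lambda>e. c)"
  by (induction c) (auto intro: prec.intros)

lemma prec_add: assumes "prec a" "prec b" shows "prec (\<lambda>e. a e + b e)"
proof (rule prec_comp2[OF _ assms])
  have "rec_nat b (\<lambda>i. Suc) a = a + b" for a b by (induction a) simp_all
  with prec_rec[OF prec_var[of 0] prec_var[of 1] prec_Suc[OF prec_var[of 0]]]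
  show "prec (\<lambda>e. e 0 + e (Suc 0))" by simp
qed

lemma prec_mult: assumes "prec a" "prec b" shows "prec (\<lambda>e. a e * b e)"
proof (rule prec_comp2[OF _ assms])
  have "rec_nat 0 (\<lambda>i r. r + b) a = a * b" for a b :: nat by (induction a) simp_all
  with prec_rec[OF prec_var[of 0] prec_zero prec_add[OF prec_var[of 0] prec_var[of 3]]]
  show "prec (\<lambda>e. e 0 * e (Suc 0))" by (simp add: numeral_3_eq_3)
qed

lemma prec_diff: assumes "prec a" "prec b" shows "prec (\<lambda>e. a e - b e)"
proof (rule prec_comp2[OF _ assms])
  have "rec_nat 0 (\<lambda>i r. i) a = a - 1" for a :: nat by (cases a) simp_all
  with prec_rec[OF prec_var[of 0] prec_zero prec_var[of 1]]
  have pred: "prec (\<lambda>e. e 0 - 1)" by simp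
  have "rec_nat a (\<lambda>i r. r - 1) b = a - b" for a b :: nat by (induction b) simp_all
  with prec_rec[OF prec_var[of 1] prec_var[of 0] pred]
  show "prec (\<lambda>e. e 0 - e (Suc 0))" by simp
qed

lemma prec_power: assumes "prec a" "prec b" shows "prec (\<lambda>e. a e ^ b e)"
proof (rule prec_comp2[OF _ assms])
  have "rec_nat 1 (\<lambda>i r. r * a) b = a ^ b" for a b :: nat by (induction b) simp_all
  with prec_rec[OF prec_var[of 1] prec_const[of 1] prec_mult[OF prec_var[of 0] prec_var[of 2]]]
  show "prec (\<lambda>e. e 0 ^ e (Suc 0))" by (simp add: numeral_2_eq_2)
qed

lemma prec_mod2: assumes "prec a" shows "prec (\<lambda>e. a e mod 2)"
proof (rule prec_comp1[OF _ assms])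
  have "rec_nat 0 (\<lambda>i r. 1 - r) a = a mod 2" for a :: nat by (induction a) (simp_all add: mod_Suc)
  with prec_rec[OF prec_var[of 0] prec_zero prec_diff[OF prec_const[of 1] prec_var[of 0]]]
  show "prec (\<lambda>e. e 0 mod 2)" by simp
qed

lemma prec_div2: assumes "prec a" shows "prec (\<lambda>e. a e div 2)"
proof (rule prec_comp1[OF _ assms])
  have "rec_nat 0 (\<lambda>i r. r + i mod 2) a = a div 2" for a :: nat by (induction a) (simp_all, presburger)
  with prec_rec[OF prec_var[of 0] prec_zero prec_add[OF prec_var[of 0] prec_mod2[OF prec_var[of 1]]]]
  show "prec (\<lambda>e. e 0 div 2)" by simp
qed

definition bt :: "nat \<Rightarrow> nat \<Rightarrow> bool" where
  "bt m p \<longleftrightarrow> odd (m div 2 ^ p)"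

lemma pd_bt: assumes "prec a" "prec b" shows "pd (\<lambda>e. bt (a e) (b e))"
proof -
  have "rec_nat a (\<lambda>i r. r div 2) b = a div 2 ^ b" for a b :: nat
    by (induction b) (simp_all add: div_mult2_eq[symmetric] mult.commute)
  with prec_rec[OF prec_var[of 1] prec_var[of 0] prec_div2[OF prec_var[of 0]]]
  have "prec (\<lambda>e. e 0 div 2 ^ e (Suc 0))" by simp
  from prec_mod2[OF prec_comp2[OF this assms]] show ?thesis
    by (simp add: bt_def mod_2_eq_odd)
qed

lemma pd_not: "pd P \<Longrightarrow> pd (\<lambda>e. \<not> P e)"
  using prec_diff[OF prec_const[of 1], of "\<lambda>e. of_bool (P e)"] by (rule back_subst[of prec]) (auto simp: fun_eq_iff)

lemma pd_conj: "pd P \<Longrightarrow> pd Q \<Longrightarrow> pd (\<lambda>e. P e \<and> Q e)"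
  using prec_mult[of "\<lambda>e. of_bool (P e)" "\<lambda>e. of_bool (Q e)"] by (rule back_subst[of prec]) (auto simp: fun_eq_iff)

lemma pd_imp: "pd P \<Longrightarrow> pd Q \<Longrightarrow> pd (\<lambda>e. P e \<longrightarrow> Q e)"
  using pd_not[OF pd_conj[OF _ pd_not[of Q]], of P] by simp

lemma pd_le: "prec a \<Longrightarrow> prec b \<Longrightarrow> pd (\<lambda>e. a e \<le> b e)"
  using prec_diff[OF prec_const[of 1] prec_diff[of a b]]
  by (rule back_subst[of prec]) (auto simp: fun_eq_iff)

lemma pd_less: "prec a \<Longrightarrow> prec b \<Longrightarrow> pd (\<lambda>e. a e < b e)"
  using pd_le[OF prec_Suc[of a]] by (simp add: Suc_le_eq)

lemma pd_eq: "prec a \<Longrightarrow> prec b \<Longrightarrow> pd (\<lambda>e. a e = (b e :: nat))"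
  using pd_conj[OF pd_le[of a b] pd_le[of b a]] by (simp add: eq_iff)

lemma pd_iff: "pd P \<Longrightarrow> pd Q \<Longrightarrow> pd (\<lambda>e. P e = Q e)"
  using pd_eq[of "\<lambda>e. of_bool (P e)" "\<lambda>e. of_bool (Q e)"]
  by (rule back_subst[of prec]) (auto simp: fun_eq_iff)

text \<open>A bounded quantifier is a product of truth values. The recursion puts its accumulator in
  front of the index, and \<open>prec_drop\<close> hides it from \<open>P\<close>.\<close>

lemma pd_all:
  assumes "prec N" "pd (\<lambda>e. P (e 0) (\<lambda>k. e (Suc k)))"
  shows "pd (\<lambda>e. \<forall>i<N e. P i e)"
proof -
  have *: "rec_nat 1 (\<lambda>i r. r * of_bool (P i)) a = (of_bool (\<forall>i<a. P i) :: nat)" for P and a :: nat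
    by (induction a) (auto simp: less_Suc_eq)
  show ?thesis
    using prec_rec[OF assms(1) prec_const[of 1] prec_mult[OF prec_var[of 0] prec_drop[OF assms(2)]]]
    by (simp add: *[simplified])
qed

lemma pd_ex:
  assumes "prec N" "pd (\<lambda>e. P (e 0) (\<lambda>k. e (Suc k)))"
  shows "pd (\<lambda>e. \<exists>i<N e. P i e)"
  using pd_not[OF pd_all[OF assms(1) pd_not[OF assms(2)]]] by simp

lemma prec_card:
  assumes "prec N" "pd (\<lambda>e. P (e 0) (\<lambda>k. e (Suc k)))"
  shows "prec (\<lambda>e. card {i. i < N e \<and> P i e})"
proof -
  have *: "rec_nat 0 (\<lambda>i r. r + of_bool (P i)) a = card {i. i < a \<and> P i}" for P and a :: nat
  proof (induction a)
    case (Suc a)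
    have "{i. i < Suc a \<and> P i} = (if P a then insert a {i. i < a \<and> P i} else {i. i < a \<and> P i})"
      by (auto simp: less_Suc_eq)
    then show ?case using Suc by simp
  qed simp
  show ?thesis
    using prec_rec[OF assms(1) prec_zero prec_add[OF prec_var[of 0] prec_drop[OF assms(2)]]]
    by (simp add: *)
qed

text \<open>\<open>W\<close> packs \<open>n + s\<close> truth tables of length \<open>2 ^ n\<close>: the \<open>n\<close> inputs, then \<open>s\<close> gates, each an arbitrary binary
  connective of earlier rows whose own truth table is the 4-bit number \<open>g\<close>.\<close>

definition valid_wires :: "nat \<Rightarrow> nat \<Rightarrow> nat \<Rightarrow> bool" where
  "valid_wires n s W \<longleftrightarrow>
     (\<forall>j<n. \<forall>x<2 ^ n. bt W (j * 2 ^ n + x) = bt x j) \<and>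
     (\<forall>i<s. \<exists>a<n + i. \<exists>b<n + i. \<exists>g<16. \<forall>x<2 ^ n. bt W ((n + i) * 2 ^ n + x) =
        bt g (2 * of_bool (bt W (a * 2 ^ n + x)) + of_bool (bt W (b * 2 ^ n + x))))"

text \<open>The last inequality is agreement below 1/2 + 1/q with denominators cleared. All
  quantifiers carry explicit primitive recursive bounds, so \<open>pd_hard_fun\<close> can follow
  the syntax.\<close>

definition hard :: "nat \<Rightarrow> nat \<Rightarrow> nat \<Rightarrow> nat \<Rightarrow> bool" where
  "hard q M n F \<longleftrightarrow> (\<forall>s<2 ^ n. s * M * n \<le> 2 ^ n \<longrightarrow> (\<forall>W<2 ^ ((n + s) * 2 ^ n). valid_wires n s W \<longrightarrow>
     2 * q * card {x. x < 2 ^ n \<and> bt F x = bt W ((n + s - 1) * 2 ^ n + x)} < (q + 2) * 2 ^ n))"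

text \<open>Where no hard table exists this is constantly false, so the machine for it needs no
  information on which \<open>n\<close> are large enough.\<close>

definition hard_fun :: "nat \<Rightarrow> nat \<Rightarrow> nat \<Rightarrow> nat \<Rightarrow> bool" where
  "hard_fun q M n v \<longleftrightarrow> (\<exists>F<2 ^ 2 ^ n. hard q M n F \<and> (\<forall>G<F. \<not> hard q M n G) \<and> bt F v)"

lemma pd_hard_fun: "pd (\<lambda>e. hard_fun q M (e 1) (e 0))"
  unfolding hard_fun_def hard_def valid_wires_def
  by (intro pd_ex pd_conj pd_all pd_imp pd_not pd_bt pd_iff pd_le pd_less pd_eq prec_card prec_add
      prec_mult prec_diff prec_power prec_const prec_var)

lemma hard_fun_tm:
  assumes "k \<ge> 1"
  shows "\<exists>T. wf_tm k T \<and> (\<forall>x. tm_out k T [True] x = Some (hard_fun q M (length x) (bits_nat x)))"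
  using prec_tm[OF pd_hard_fun assms, of q M] by simp

section \<open>Encoding and memorising with circuits\<close>

lemma le_clog: "n \<le> 2 ^ clog n"
  unfolding clog_def by (rule LeastI[of _ n]) (simp add: less_imp_le)

lemma clog_mono: "a \<le> b \<Longrightarrow> clog a \<le> clog b"
  unfolding clog_def[of a] by (rule Least_le) (use le_clog order_trans in blast)

primrec nat_bits :: "nat \<Rightarrow> nat \<Rightarrow> bool list" where
  "nat_bits 0 v = []"
| "nat_bits (Suc w) v = nat_bits w (v div 2) @ [odd v]"

lemma length_nat_bits [simp]: "length (nat_bits w v) = w"
  by (induction w arbitrary: v) auto

lemma bits_nat_Nil [simp]: "bits_nat [] = 0"
  by (simp add: bits_nat_def)

lemma bits_nat_nat_bits [simp]: "v < 2 ^ w \<Longrightarrow> bits_nat (nat_bits w v) = v"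
proof (induction w arbitrary: v)
  case (Suc w)
  then have "bits_nat (nat_bits w (v div 2)) = v div 2" by simp
  then show ?case by (simp add: bits_nat_snoc)
qed simp

lemma bits_nat_less: "bits_nat bs < 2 ^ length bs"
  by (induction bs rule: rev_induct) (auto simp: bits_nat_snoc)

text \<open>Strings have the most significant bit first while \<open>bt\<close> counts from the
  least significant one; this reverses input indices in wire tables.\<close>

lemma nth_bt: "j < length x \<Longrightarrow> x ! j = bt (bits_nat x) (length x - 1 - j)"
proof (induction x rule: rev_induct)
  case (snoc b xs)
  show ?case
  proof (cases "j = length xs")
    case True
    then show ?thesis by (simp add: bits_nat_snoc bt_def)
  next
    case False
    then have j: "j < length xs" using snoc.prems by simp
    then have "length xs - j = Suc (length xs - 1 - j)" by simp
    moreover have "(2 * bits_nat xs + (if b then 1 else 0)) div 2 ^ Suc p = bits_nat xs div 2 ^ p" for p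
      by (simp add: div_mult2_eq)
    ultimately show ?thesis using snoc.IH[OF j] j
      by (simp add: nth_append bits_nat_snoc bt_def)
  qed
qed simp

lemma nat_bits_bits_nat:
  assumes "length x = n"
  shows "nat_bits n (bits_nat x) = x"
proof (rule nth_equalityI)
  fix j assume j: "j < length (nat_bits n (bits_nat x))"
  have "bits_nat (nat_bits n (bits_nat x)) = bits_nat x"
    using assms bits_nat_less[of x] by simp
  then show "nat_bits n (bits_nat x) ! j = x ! j"
    using nth_bt[of j x] nth_bt[of j "nat_bits n (bits_nat x)"] j assms by simp
qed (use assms in simp)

lemma bij_betw_bits_nat: "bij_betw bits_nat {x. length x = n} {..<2 ^ n}"
  by (rule bij_betwI[where g = "nat_bits n"]) (use bits_nat_less nat_bits_bits_nat in auto)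

section \<open>Encoding circuits as programs\<close>

fun enc_vertex :: "nat \<Rightarrow> nat \<Rightarrow> nat \<Rightarrow> gate \<Rightarrow> bool list" where
  "enc_vertex n c w (Inp j) = [False, False] @ nat_bits (clog n) j @ replicate (w - clog n) False"
| "enc_vertex n c w (NotG a) = [False, True] @ nat_bits c a @ replicate (w - c) False"
| "enc_vertex n c w (AndG a b) = [True, False] @ nat_bits c a @ nat_bits c b @ replicate (w - 2 * c) False"
| "enc_vertex n c w (OrG a b) = [True, True] @ nat_bits c a @ nat_bits c b @ replicate (w - 2 * c) False"

definition circ_len :: "nat \<Rightarrow> nat \<Rightarrow> nat" where
  "circ_len s n = 2 * clog n + 2 + s * (3 + max (2 * clog s) (clog n))"

definition enc_circ :: "nat \<Rightarrow> gate list \<Rightarrow> bool list" where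
  "enc_circ n gs = (let s = length gs; c = clog s; w = max (2 * c) (clog n) in
     replicate (clog n) False @ True # nat_bits (clog n + 1) n @ replicate (s - 1) False @ True #
     concat (map (enc_vertex n c w) gs))"

text \<open>Strictness lets a comparison of program lengths be read as a comparison of vertex
  counts.\<close>

lemma circ_len_strict: "s < s' \<Longrightarrow> circ_len s n < circ_len s' n"
proof -
  assume "s < s'"
  then have "s * (3 + max (2 * clog s) (clog n)) \<le> s * (3 + max (2 * clog s') (clog n))"
    using clog_mono[of s s'] by (intro mult_le_mono2) auto
  also have "\<dots> < s' * (3 + max (2 * clog s') (clog n))" using \<open>s < s'\<close> by simp
  finally show ?thesis by (simp add: circ_len_def)
qed

lemma length_enc_vertex: "2 * c \<le> w \<Longrightarrow> clog n \<le> w \<Longrightarrow> length (enc_vertex n c w g) = 2 + w"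
  by (cases g) auto

lemma block_concat:
  "(\<And>x. x \<in> set xs \<Longrightarrow> length (f x) = l) \<Longrightarrow> i < length xs \<Longrightarrow>
    take l (drop (i * l) (concat (map f xs))) = f (xs ! i)"
proof (induction xs arbitrary: i)
  case (Cons a xs)
  then show ?case by (cases i) auto
qed simp

lemma length_block_concat:
  "(\<And>x. x \<in> set xs \<Longrightarrow> length (f x) = l) \<Longrightarrow> length (concat (map f xs)) = length xs * l"
  by (induction xs) auto

lemma takeWhile_replicate_False: "takeWhile Not (replicate a False @ True # ys) = replicate a False"
  by (induction a) auto

fun gate_ok :: "nat \<Rightarrow> nat \<Rightarrow> gate \<Rightarrow> bool" where
  "gate_ok n i (Inp j) = (j < n)"
| "gate_ok n i (NotG a) = (a < i)"
| "gate_ok n i (AndG a b) = (a < i \<and> b < i)"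
| "gate_ok n i (OrG a b) = (a < i \<and> b < i)"

fun parents :: "gate \<Rightarrow> nat set" where
  "parents (Inp j) = {}"
| "parents (NotG a) = {a}"
| "parents (AndG a b) = {a, b}"
| "parents (OrG a b) = {a, b}"

lemma valid_circ_iff:
  "valid_circ n gs \<longleftrightarrow> n \<ge> 1 \<and> gs \<noteq> [] \<and> (\<forall>i<length gs. gate_ok n i (gs ! i)) \<and>
    {..<length gs - 1} \<subseteq> \<Union> (parents ` set gs)"
proof -
  have 1: "(case g of Inp j \<Rightarrow> j < n | NotG a \<Rightarrow> a < i | AndG a b \<Rightarrow> a < i \<and> b < i | OrG a b \<Rightarrow> a < i \<and> b < i)
     = gate_ok n i g" for i g by (cases g) auto
  have 2: "(case g of Inp _ \<Rightarrow> False | NotG a \<Rightarrow> a = i | AndG a b \<Rightarrow> a = i \<or> b = i | OrG a b \<Rightarrow> a = i \<or> b = i)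
     = (i \<in> parents g)" for i g by (cases g) auto
  have 3: "(\<exists>j<length gs. i \<in> parents (gs ! j)) = (i \<in> \<Union> (parents ` set gs))" for i
    by simp (metis in_set_conv_nth)
  show ?thesis unfolding valid_circ_def 1 2 3 by auto
qed

lemma decode_enc_vertex:
  assumes "gate_ok n s g" "c = clog s" "w = max (2 * c) (clog n)"
  shows "decode_vertex n s (enc_vertex n c w g) = g"
proof -
  have "j < n \<Longrightarrow> j < 2 ^ clog n" for j using le_clog[of n] by simp
  moreover have "j < s \<Longrightarrow> j < 2 ^ clog s" for j using le_clog[of s] by simp
  ultimately show ?thesis using assms by (cases g) (auto simp: decode_vertex_def Let_def)
qed

lemma gate_ok_mono: "gate_ok n i g \<Longrightarrow> i \<le> s \<Longrightarrow> gate_ok n s g"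
  by (cases g) auto

lemma circ_decode_enc:
  assumes "valid_circ n gs"
  shows "circ_decode (enc_circ n gs) = Some (n, gs)" "length (enc_circ n gs) = circ_len (length gs) n"
proof -
  define s c w where "s = length gs" and "c = clog s" and "w = max (2 * c) (clog n)"
  define body where "body = concat (map (enc_vertex n c w) gs)"
  have s: "s \<ge> 1" and n: "n \<ge> 1" and ok: "\<And>i. i < s \<Longrightarrow> gate_ok n i (gs ! i)"
    using assms unfolding valid_circ_iff s_def by (auto simp: Suc_le_eq)
  have len: "length (enc_vertex n c w g) = 2 + w" for g
    by (rule length_enc_vertex) (auto simp: w_def)
  have body_len: "length body = s * (2 + w)"
    unfolding body_def s_def by (rule length_block_concat) (rule len)
  have enc: "enc_circ n gs = replicate (clog n) False @ True # nat_bits (clog n + 1) n @ replicate (s - 1) False @ True # body"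
    unfolding enc_circ_def body_def s_def c_def w_def Let_def ..
  \<comment> \<open>\<open>n\<close> may equal \<open>2 ^ clog n\<close>, hence the extra
    bit.\<close>
  have "n < 2 ^ (clog n + 1)" using le_clog[of n] n by simp
  then have nb: "bits_nat (nat_bits (clog n + 1) n) = n" by (rule bits_nat_nat_bits)
  have "map (\<lambda>i. decode_vertex n s (take (2 + w) (drop (i * (2 + w)) body))) [0..<s] = gs"
  proof (rule nth_equalityI)
    fix i assume "i < length (map (\<lambda>i. decode_vertex n s (take (2 + w) (drop (i * (2 + w)) body))) [0..<s])"
    then have i: "i < s" by simp
    have "take (2 + w) (drop (i * (2 + w)) body) = enc_vertex n c w (gs ! i)"
      unfolding body_def by (rule block_concat) (use len i s_def in auto)
    moreover have "gate_ok n s (gs ! i)" using ok[OF i] i by (auto intro: gate_ok_mono)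
    ultimately show "map (\<lambda>i. decode_vertex n s (take (2 + w) (drop (i * (2 + w)) body))) [0..<s] ! i = gs ! i"
      using i decode_enc_vertex[of n s "gs ! i" c w] by (simp add: c_def w_def)
  qed (simp add: s_def)
  then show "circ_decode (enc_circ n gs) = Some (n, gs)"
    using s n nb body_len unfolding circ_decode_def enc
    by (simp add: takeWhile_replicate_False Let_def w_def c_def)
  show "length (enc_circ n gs) = circ_len (length gs) n"
    using s body_len unfolding enc circ_len_def w_def c_def by (simp add: s_def[symmetric] algebra_simps)
qed

text \<open>A selected program need not come from \<open>enc_circ\<close>, since padding bits are
  free; its length has to be read off from the decoder.\<close>

lemma circ_decode_length:
  assumes "circ_decode h = Some (n, gs)"
  shows "length h = circ_len (length gs) n"
proof -
  define a where "a = length (takeWhile Not h)"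
  define r1 where "r1 = drop (a + 1) h"
  define r2 where "r2 = drop (a + 1) r1"
  define s' where "s' = length (takeWhile Not r2)"
  define r3 where "r3 = drop (s' + 1) r2"
  have *: "a < length h" "a + 1 \<le> length r1" "clog n = a" "s' < length r2" "length gs = s' + 1"
    "length r3 = (s' + 1) * (2 + max (2 * clog (s' + 1)) (clog n))"
    using assms unfolding circ_decode_def Let_def
    by (auto simp: a_def r1_def r2_def r3_def s'_def not_le not_less split: if_splits)
  have "length h = a + 1 + length r1" "length r1 = a + 1 + length r2" "length r2 = s' + 1 + length r3"
    using * by (auto simp: r1_def r2_def r3_def)
  then show ?thesis using * unfolding circ_len_def by (simp add: algebra_simps)
qed

definition vals :: "gate list \<Rightarrow> bool list \<Rightarrow> bool list" where
  "vals gs x = foldl (\<lambda>vs g. vs @ [gate_val x vs g]) [] gs"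

lemma vals_snoc: "vals (gs @ [g]) x = vals gs x @ [gate_val x (vals gs x) g]"
  by (simp add: vals_def)

lemma length_vals [simp]: "length (vals gs x) = length gs"
  by (induction gs rule: rev_induct) (simp_all add: vals_snoc, simp add: vals_def)

text \<open>Gates refer to earlier positions only, so values appended later do not affect a gate
  already evaluated.\<close>

lemma vals_nth:
  "(\<And>i. i < length gs \<Longrightarrow> gate_ok n i (gs ! i)) \<Longrightarrow> i < length gs \<Longrightarrow>
    vals gs x ! i = gate_val x (vals gs x) (gs ! i)"
proof (induction gs rule: rev_induct)
  case (snoc g gs)
  have ok: "gate_ok n j (gs ! j)" if "j < length gs" for j
    using snoc.prems(1)[of j] that by (simp add: nth_append)
  have ext: "gate_val x (vals gs x @ ys) g' = gate_val x (vals gs x) g'" if "gate_ok n (length gs) g'" for ys g'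
    using that by (cases g') (auto simp: nth_append)
  show ?case
  proof (cases "i < length gs")
    case True
    then show ?thesis
      using snoc.IH[OF ok True] ext[OF gate_ok_mono[OF ok[OF True]]] by (simp add: vals_snoc nth_append)
  next
    case False
    then have i: "i = length gs" using snoc.prems by simp
    have "gate_ok n (length gs) g" using snoc.prems(1)[of "length gs"] by simp
    then show ?thesis using i ext by (simp add: vals_snoc nth_append)
  qed
qed simp

section \<open>Formulas and memorisation\<close>

text \<open>Formulas rather than shared circuits: each vertex of a tree but the root has exactly one
  child, which gives the unique sink demanded by \<open>valid_circ\<close> for free.\<close>

datatype fm = FInp nat | FNot fm | FAnd fm fm | FOr fm fm

fun fm_val :: "bool list \<Rightarrow> fm \<Rightarrow> bool" where
  "fm_val x (FInp j) = x ! j"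
| "fm_val x (FNot a) = (\<not> fm_val x a)"
| "fm_val x (FAnd a b) = (fm_val x a \<and> fm_val x b)"
| "fm_val x (FOr a b) = (fm_val x a \<or> fm_val x b)"

fun fm_size :: "fm \<Rightarrow> nat" where
  "fm_size (FInp j) = 1"
| "fm_size (FNot a) = fm_size a + 1"
| "fm_size (FAnd a b) = fm_size a + fm_size b + 1"
| "fm_size (FOr a b) = fm_size a + fm_size b + 1"

fun fm_inputs :: "fm \<Rightarrow> nat set" where
  "fm_inputs (FInp j) = {j}"
| "fm_inputs (FNot a) = fm_inputs a"
| "fm_inputs (FAnd a b) = fm_inputs a \<union> fm_inputs b"
| "fm_inputs (FOr a b) = fm_inputs a \<union> fm_inputs b"

text \<open>Post-order with the root last. Parents are absolute positions, hence the offset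
  \<open>p\<close> of vertices already listed.\<close>

fun fm_gates :: "nat \<Rightarrow> fm \<Rightarrow> gate list" where
  "fm_gates p (FInp j) = [Inp j]"
| "fm_gates p (FNot a) = fm_gates p a @ [NotG (p + fm_size a - 1)]"
| "fm_gates p (FAnd a b) = fm_gates p a @ fm_gates (p + fm_size a) b @
     [AndG (p + fm_size a - 1) (p + fm_size a + fm_size b - 1)]"
| "fm_gates p (FOr a b) = fm_gates p a @ fm_gates (p + fm_size a) b @
     [OrG (p + fm_size a - 1) (p + fm_size a + fm_size b - 1)]"

lemma fm_size_pos [simp]: "fm_size a > 0" "fm_size a \<noteq> 0"
  by (cases a; simp)+

lemma length_fm_gates [simp]: "length (fm_gates p a) = fm_size a"
  by (induction a arbitrary: p) auto

lemma fm_gates_ok: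
  "fm_inputs a \<subseteq> {..<n} \<Longrightarrow> i < fm_size a \<Longrightarrow> gate_ok n (p + i) (fm_gates p a ! i)"
proof (induction a arbitrary: p i)
  case (FInp j)
  then show ?case by simp
next
  case (FNot a)
  then show ?case using fm_size_pos(1)[of a]
    by (cases "i < fm_size a") (auto simp: nth_append simp del: fm_size_pos)
next
  case (FAnd a b)
  have "gate_ok n (p + i) (fm_gates (p + fm_size a) b ! (i - fm_size a))"
    if "\<not> i < fm_size a" "i - fm_size a < fm_size b"
    using FAnd.IH(2)[of "i - fm_size a" "p + fm_size a"] FAnd.prems that by simp
  moreover have "i = fm_size a + fm_size b" if "\<not> i < fm_size a" "\<not> i - fm_size a < fm_size b"
    using FAnd.prems that by simp
  ultimately show ?case using FAnd fm_size_pos[of a] fm_size_pos[of b] by (auto simp: nth_append simp del: fm_size_pos)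
next
  case (FOr a b)
  have "gate_ok n (p + i) (fm_gates (p + fm_size a) b ! (i - fm_size a))"
    if "\<not> i < fm_size a" "i - fm_size a < fm_size b"
    using FOr.IH(2)[of "i - fm_size a" "p + fm_size a"] FOr.prems that by simp
  moreover have "i = fm_size a + fm_size b" if "\<not> i < fm_size a" "\<not> i - fm_size a < fm_size b"
    using FOr.prems that by simp
  ultimately show ?case using FOr fm_size_pos[of a] fm_size_pos[of b] by (auto simp: nth_append simp del: fm_size_pos)
qed

text \<open>Beyond the induction hypotheses only the roots of the immediate subformulas need
  covering, and the appended gate refers to them.\<close>

lemma fm_gates_parents: "{p..<p + fm_size a - 1} \<subseteq> \<Union> (parents ` set (fm_gates p a))"
proof (induction a arbitrary: p)
  case (FInp j)
  then show ?case by simp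
next
  case (FNot a)
  have "{p..<p + fm_size (FNot a) - 1} \<subseteq> {p..<p + fm_size a - 1} \<union> {p + fm_size a - 1}" by auto
  then show ?case using FNot[of p] by auto
next
  case (FAnd a b)
  have "{p..<p + fm_size (FAnd a b) - 1} \<subseteq> {p..<p + fm_size a - 1} \<union> {p + fm_size a - 1}
     \<union> {p + fm_size a..<p + fm_size a + fm_size b - 1} \<union> {p + fm_size a + fm_size b - 1}" by auto
  then show ?case using FAnd.IH(1)[of p] FAnd.IH(2)[of "p + fm_size a"] by simp blast
next
  case (FOr a b)
  have "{p..<p + fm_size (FOr a b) - 1} \<subseteq> {p..<p + fm_size a - 1} \<union> {p + fm_size a - 1}
     \<union> {p + fm_size a..<p + fm_size a + fm_size b - 1} \<union> {p + fm_size a + fm_size b - 1}" by auto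
  then show ?case using FOr.IH(1)[of p] FOr.IH(2)[of "p + fm_size a"] by simp blast
qed

text \<open>The prefix \<open>vs\<close> is arbitrary because the second subformula is evaluated
  after the first.\<close>

lemma fm_gates_vals:
  "\<exists>us. foldl (\<lambda>vs g. vs @ [gate_val x vs g]) vs (fm_gates (length vs) a) = vs @ us
     \<and> length us = fm_size a \<and> us ! (fm_size a - 1) = fm_val x a"
proof (induction a arbitrary: vs)
  case (FInp j)
  then show ?case by simp
next
  case (FNot a)
  from FNot[of vs] obtain us where us: "foldl (\<lambda>vs g. vs @ [gate_val x vs g]) vs (fm_gates (length vs) a) = vs @ us"
    "length us = fm_size a" "us ! (fm_size a - 1) = fm_val x a" by blast
  have "(vs @ us) ! (length vs + fm_size a - 1) = us ! (fm_size a - 1)"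
  proof -
    have "length vs + fm_size a - 1 = length vs + (fm_size a - 1)" using fm_size_pos(1)[of a] by linarith
    then show ?thesis by (simp only: nth_append_length_plus)
  qed
  then show ?case using us by (auto simp: nth_append)
next
  case (FAnd a b)
  from FAnd.IH(1)[of vs] obtain us where us: "foldl (\<lambda>vs g. vs @ [gate_val x vs g]) vs (fm_gates (length vs) a) = vs @ us"
    "length us = fm_size a" "us ! (fm_size a - 1) = fm_val x a" by blast
  from FAnd.IH(2)[of "vs @ us"] obtain us' where us': "foldl (\<lambda>vs g. vs @ [gate_val x vs g]) (vs @ us)
    (fm_gates (length vs + fm_size a) b) = vs @ us @ us'"
    "length us' = fm_size b" "us' ! (fm_size b - 1) = fm_val x b" using us by auto
  have "length vs + fm_size a - 1 = length vs + (fm_size a - 1)"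
    "length vs + fm_size a + fm_size b - 1 = length vs + (length us + (fm_size b - 1))"
    using fm_size_pos(1)[of a] fm_size_pos(1)[of b] us(2) by linarith+
  then have "(vs @ us @ us') ! (length vs + fm_size a - 1) = fm_val x a"
    "(vs @ us @ us') ! (length vs + fm_size a + fm_size b - 1) = fm_val x b"
    using us us' fm_size_pos[of a] by (simp_all only: nth_append_length_plus) (simp_all add: nth_append)
  then show ?case using us us' by (intro exI[of _ "us @ us' @ [fm_val x (FAnd a b)]"]) (simp add: nth_append)
next
  case (FOr a b)
  from FOr.IH(1)[of vs] obtain us where us: "foldl (\<lambda>vs g. vs @ [gate_val x vs g]) vs (fm_gates (length vs) a) = vs @ us"
    "length us = fm_size a" "us ! (fm_size a - 1) = fm_val x a" by blast
  from FOr.IH(2)[of "vs @ us"] obtain us' where us': "foldl (\<lambda>vs g. vs @ [gate_val x vs g]) (vs @ us)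
    (fm_gates (length vs + fm_size a) b) = vs @ us @ us'"
    "length us' = fm_size b" "us' ! (fm_size b - 1) = fm_val x b" using us by auto
  have "length vs + fm_size a - 1 = length vs + (fm_size a - 1)"
    "length vs + fm_size a + fm_size b - 1 = length vs + (length us + (fm_size b - 1))"
    using fm_size_pos(1)[of a] fm_size_pos(1)[of b] us(2) by linarith+
  then have "(vs @ us @ us') ! (length vs + fm_size a - 1) = fm_val x a"
    "(vs @ us @ us') ! (length vs + fm_size a + fm_size b - 1) = fm_val x b"
    using us us' fm_size_pos[of a] by (simp_all only: nth_append_length_plus) (simp_all add: nth_append)
  then show ?case using us us' by (intro exI[of _ "us @ us' @ [fm_val x (FOr a b)]"]) (simp add: nth_append)
qed

lemma circ_eval_fm_gates: "circ_eval (fm_gates 0 a) x = fm_val x a"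
proof -
  obtain us where "foldl (\<lambda>vs g. vs @ [gate_val x vs g]) [] (fm_gates 0 a) = us"
    "length us = fm_size a" "us ! (fm_size a - 1) = fm_val x a" using fm_gates_vals[of x "[]" a] by auto
  moreover from this have "us \<noteq> []" using fm_size_pos[of a] by auto
  ultimately show ?thesis by (simp add: circ_eval_def last_conv_nth)
qed

lemma valid_circ_fm_gates:
  assumes "n \<ge> 1" "fm_inputs a \<subseteq> {..<n}"
  shows "valid_circ n (fm_gates 0 a)"
proof -
  have "fm_gates 0 a \<noteq> []" using fm_size_pos[of a] by (metis length_fm_gates less_numeral_extra(3) list.size(3))
  moreover have "{..<fm_size a - 1} = {0..<0 + fm_size a - 1}" by auto
  ultimately show ?thesis
    using fm_gates_ok[OF assms(2), of _ 0] fm_gates_parents[of 0 a] assms(1)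
    unfolding valid_circ_iff by simp
qed

text \<open>Branching on a bit where two points of \<open>D\<close> differ leaves both halves nonempty, so the decision
  tree has \<open>card D\<close> leaves; its size does not depend on \<open>n\<close> because nothing is asked off \<open>D\<close>.\<close>

lemma memorise:
  assumes "finite D" "D \<noteq> {}" "\<And>x. x \<in> D \<Longrightarrow> length x = n" "n \<ge> 1"
  shows "\<exists>a. fm_inputs a \<subseteq> {..<n} \<and> fm_size a + 6 \<le> 10 * card D \<and> (\<forall>x\<in>D. fm_val x a = f x)"
  using assms(1-3)
proof (induction "card D" arbitrary: D rule: less_induct)
  case less
  show ?case
  proof (cases "card D = 1")
    case True
    then obtain x where D: "D = {x}" by (auto simp: card_1_singleton_iff)
    \<comment> \<open>There are no constant gates, so constants are built from input 0, which exists
      as \<open>n \<ge> 1\<close>. They take 4 vertices; with the slack 6 this gives the 10.\<close>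
    define a where "a = (if f x then FOr (FInp 0) (FNot (FInp 0)) else FAnd (FInp 0) (FNot (FInp 0)))"
    show ?thesis using assms(4) D by (intro exI[of _ a]) (auto simp: a_def)
  next
    case False
    moreover have "card D > 0" using less.prems by (simp add: card_gt_0_iff)
    ultimately have "\<not> card D \<le> Suc 0" by simp
    then obtain x y where xy: "x \<in> D" "y \<in> D" "x \<noteq> y"
      using less.prems card_le_Suc0_iff_eq[of D] by auto
    then have "\<exists>i<n. x ! i \<noteq> y ! i" using less.prems(3) nth_equalityI[of x y] by fastforce
    then obtain i where i: "i < n" "x ! i \<noteq> y ! i" by blast
    define A B where "A = {z \<in> D. z ! i}" and "B = {z \<in> D. \<not> z ! i}"
    have AB: "D = A \<union> B" "A \<inter> B = {}" "finite A" "finite B" "A \<noteq> {}" "B \<noteq> {}"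
      using xy i less.prems(1) by (auto simp: A_def B_def)
    then have card: "card D = card A + card B" "card A > 0" "card B > 0"
      by (simp_all add: card_Un_disjoint card_gt_0_iff)
    have "\<exists>a. fm_inputs a \<subseteq> {..<n} \<and> fm_size a + 6 \<le> 10 * card A \<and> (\<forall>x\<in>A. fm_val x a = f x)"
      by (rule less.hyps) (use card AB less.prems in auto)
    moreover have "\<exists>a. fm_inputs a \<subseteq> {..<n} \<and> fm_size a + 6 \<le> 10 * card B \<and> (\<forall>x\<in>B. fm_val x a = f x)"
      by (rule less.hyps) (use card AB less.prems in auto)
    ultimately obtain a b where
      a: "fm_inputs a \<subseteq> {..<n}" "fm_size a + 6 \<le> 10 * card A" "\<forall>x\<in>A. fm_val x a = f x" and
      b: "fm_inputs b \<subseteq> {..<n}" "fm_size b + 6 \<le> 10 * card B" "\<forall>x\<in>B. fm_val x b = f x" by blast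
    \<comment> \<open>Branching adds 6 vertices, paid by one of the two slacks of 6; the other slack
      is kept for the claim.\<close>
    show ?thesis
    proof (intro exI[of _ "FOr (FAnd (FInp i) a) (FAnd (FNot (FInp i)) b)"] conjI ballI)
      show "fm_val x (FOr (FAnd (FInp i) a) (FAnd (FNot (FInp i)) b)) = f x" if "x \<in> D" for x
        using a(3) b(3) that by (cases "x ! i") (auto simp: A_def B_def)
    qed (use a(1,2) b(1,2) i(1) card(1) in auto)
  qed
qed

lemma mdl_circ_selected:
  assumes sel: "mdl_selector circ_interp sel" and n: "n \<ge> 1" and xs: "xs \<noteq> []" "\<And>x. x \<in> set xs \<Longrightarrow> length x = n"
  shows "\<exists>gs. valid_circ n gs \<and> length gs \<le> 10 * length xs \<and>
    (\<forall>x. length x = n \<longrightarrow> circ_interp (sel n (labelled f xs)) x = Some (circ_eval gs x))"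
proof -
  obtain a where a: "fm_inputs a \<subseteq> {..<n}" "fm_size a + 6 \<le> 10 * card (set xs)" "\<forall>x\<in>set xs. fm_val x a = f x"
    using memorise[of "set xs" n f] xs n by auto
  define g0 where "g0 = fm_gates 0 a"
  have g0: "valid_circ n g0" using valid_circ_fm_gates[OF n a(1)] by (simp add: g0_def)
  let ?C = "mdl_cands circ_interp n (labelled f xs)"
  let ?h = "sel n (labelled f xs)"
  have "circ_interp (enc_circ n g0) x = Some (fm_val x a)" if "length x = n" for x
    using circ_decode_enc[OF g0] g0 that by (simp add: circ_interp_def g0_def circ_eval_fm_gates)
  then have "enc_circ n g0 \<in> ?C" using a(3) xs(2) by (auto simp: mdl_cands_def labelled_def)
  then have h: "?h \<in> ?C" "length ?h \<le> length (enc_circ n g0)"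
    using sel unfolding mdl_selector_def by blast+
  \<comment> \<open>One input of length \<open>n\<close> is enough: \<open>circ_interp\<close> is
    undefined on wrong lengths, so the decoded arity is \<open>n\<close>.\<close>
  have "length (replicate n False) = n" by simp
  then have "circ_interp ?h (replicate n False) \<noteq> None" using h(1) by (simp add: mdl_cands_def)
  then obtain gs where gs: "circ_decode ?h = Some (n, gs)" "valid_circ n gs"
    by (auto simp: circ_interp_def split: option.splits if_splits)
  have "\<not> length g0 < length gs"
  proof
    assume "length g0 < length gs"
    from circ_len_strict[OF this, of n] show False
      using h(2) circ_decode_length[OF gs(1)] circ_decode_enc(2)[OF g0] by simp
  qed
  moreover have "length g0 \<le> 10 * length xs"
    using a(2) card_length[of xs] by (simp add: g0_def)
  ultimately show ?thesis using gs by (intro exI[of _ gs]) (auto simp: circ_interp_def)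
qed

section \<open>Circuits as wire tables\<close>

lemma bt_set_encode: "finite A \<Longrightarrow> bt (set_encode A) p \<longleftrightarrow> p \<in> A"
  using set_encode_inverse[of A] by (auto simp: set_decode_def bt_def)

lemma set_encode_less: "A \<subseteq> {..<N} \<Longrightarrow> set_encode A < 2 ^ N"
proof -
  assume A: "A \<subseteq> {..<N}"
  have "set_encode A \<le> (\<Sum>i<N. 2 ^ i)"
    unfolding set_encode_def using A by (intro sum_mono2) auto
  also have "\<dots> < 2 ^ N" by (induction N) auto
  finally show ?thesis .
qed

text \<open>Each vertex becomes one row after the \<open>n\<close> input rows, an input vertex being
  a copy of its row, so the gate count stays the same.\<close>

lemma circ_wires:
  assumes "valid_circ n gs"
  shows "\<exists>W<2 ^ ((n + length gs) * 2 ^ n). valid_wires n (length gs) W \<and>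
    (\<forall>x. length x = n \<longrightarrow> bt W ((n + length gs - 1) * 2 ^ n + bits_nat x) = circ_eval gs x)"
proof -
  define s where "s = length gs"
  have n: "n \<ge> 1" and s: "s \<ge> 1" and ok: "\<And>i. i < s \<Longrightarrow> gate_ok n i (gs ! i)"
    using assms unfolding valid_circ_iff s_def by (auto simp: Suc_le_eq)
  define row where "row = (\<lambda>i v. if i < n then bt v i else vals gs (nat_bits n v) ! (i - n))"
  define A where "A = {p. p < (n + s) * 2 ^ n \<and> row (p div 2 ^ n) (p mod 2 ^ n)}"
  have A: "finite A" "A \<subseteq> {..<(n + s) * 2 ^ n}" by (auto simp: A_def)
  define W where "W = set_encode A"
  have W: "bt W (i * 2 ^ n + v) = row i v" if "i < n + s" "v < 2 ^ n" for i v
  proof -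
    have "i * 2 ^ n + v < Suc i * 2 ^ n" using that by simp
    also have "\<dots> \<le> (n + s) * 2 ^ n" using that by (intro mult_le_mono1) simp
    finally have "i * 2 ^ n + v \<in> A \<longleftrightarrow> row i v" using that by (simp add: A_def)
    then show ?thesis by (simp only: W_def bt_set_encode[OF A(1)])
  qed
  have out: "bt W ((n + s - 1) * 2 ^ n + bits_nat x) = circ_eval gs x" if "length x = n" for x
  proof -
    note x = nat_bits_bits_nat[OF that]
    have "bt W ((n + s - 1) * 2 ^ n + bits_nat x) = row (n + s - 1) (bits_nat x)"
      using W[of "n + s - 1" "bits_nat x"] s n bits_nat_less[of x] that by simp
    also have "\<dots> = vals gs x ! (s - 1)"
    proof -
      have "\<not> n + s - 1 < n" "n + s - 1 - n = s - 1" using s by linarith+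
      then show ?thesis by (simp only: row_def x if_False)
    qed
    also have "\<dots> = circ_eval gs x"
    proof -
      have "vals gs x \<noteq> []" using s by (metis length_vals list.size(3) not_one_le_zero s_def)
      then show ?thesis by (simp add: circ_eval_def vals_def[symmetric] last_conv_nth s_def)
    qed
    finally show ?thesis .
  qed
  have gate: "\<exists>a<n + i. \<exists>b<n + i. \<exists>g<16. \<forall>v<2 ^ n. row (n + i) v = bt g (2 * of_bool (row a v) + of_bool (row b v))"
    if i: "i < s" for i
  proof -
    have r: "row (n + i) v = gate_val (nat_bits n v) (vals gs (nat_bits n v)) (gs ! i)" for v
      using vals_nth[of gs n i] ok i by (simp add: row_def s_def)
    have old: "row (n + a) v = vals gs (nat_bits n v) ! a" for a v by (simp add: row_def)
    \<comment> \<open>Connectives are read at index 2a + b: 8 is conjunction, 14 disjunction, 1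
      holds at index 0 only. With equal arguments just 0 and 3 occur, so 1 negates and 8
      copies.\<close>
    have bt1: "bt (Suc 0) 0" "\<not> bt (Suc 0) 3" by (simp_all add: bt_def)
    have bt8: "\<not> bt 8 0" "\<not> bt 8 (Suc 0)" "\<not> bt 8 2" "bt 8 3" by (simp_all add: bt_def)
    have bt14: "\<not> bt 14 0" "bt 14 (Suc 0)" "bt 14 2" "bt 14 3" by (simp_all add: bt_def)
    have wit: ?thesis if "a < n + i" "b < n + i" "g < 16"
      "\<And>v. v < 2 ^ n \<Longrightarrow> row (n + i) v = bt g (2 * of_bool (row a v) + of_bool (row b v))" for a b g
      using that by blast
    show ?thesis
    proof (cases "gs ! i")
      case (Inp j)
      then have j: "j < n" using ok[OF i] by simp
      have "row (n + i) v = row (n - 1 - j) v" if "v < 2 ^ n" for v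
        using r[of v] nth_bt[of j "nat_bits n v"] j that by (simp add: Inp row_def)
      then show ?thesis using j i bt8
        by (intro wit[of "n - 1 - j" "n - 1 - j" 8]) auto
    next
      case (NotG a)
      then have "a < i" using ok[OF i] by simp
      then show ?thesis using r bt1 by (intro wit[of "n + a" "n + a" 1]) (simp_all add: NotG old)
    next
      case (AndG a b)
      then have "a < i" "b < i" using ok[OF i] by auto
      then show ?thesis using r bt8 by (intro wit[of "n + a" "n + b" 8]) (simp_all add: AndG old)
    next
      case (OrG a b)
      then have "a < i" "b < i" using ok[OF i] by auto
      then show ?thesis using r bt14 by (intro wit[of "n + a" "n + b" 14]) (simp_all add: OrG old)
    qed
  qed
  have "valid_wires n s W"
    unfolding valid_wires_def
  proof (intro conjI allI impI)
    show "bt W (j * 2 ^ n + v) = bt v j" if "j < n" "v < 2 ^ n" for j v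
      using W[of j v] that by (simp add: row_def)
    fix i assume i: "i < s"
    from gate[OF i] obtain a b g where abg: "a < n + i" "b < n + i" "g < 16"
      "\<forall>v<2 ^ n. row (n + i) v = bt g (2 * of_bool (row a v) + of_bool (row b v))" by blast
    have "bt W ((n + i) * 2 ^ n + v) = bt g (2 * of_bool (bt W (a * 2 ^ n + v)) + of_bool (bt W (b * 2 ^ n + v)))"
      if "v < 2 ^ n" for v
      using W[of "n + i" v] W[of a v] W[of b v] abg i that by simp
    then show "\<exists>a<n + i. \<exists>b<n + i. \<exists>g<16. \<forall>v<2 ^ n. bt W ((n + i) * 2 ^ n + v) =
        bt g (2 * of_bool (bt W (a * 2 ^ n + v)) + of_bool (bt W (b * 2 ^ n + v)))"
      using abg by blast
  qed
  moreover have "W < 2 ^ ((n + s) * 2 ^ n)" unfolding W_def by (rule set_encode_less) (rule A)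
  ultimately show ?thesis using out unfolding s_def by blast
qed

section \<open>Sample bound for short programs\<close>

lemma emeasure_replicate_pmf:
  "emeasure (replicate_pmf m P) {xs. set xs \<subseteq> A} = emeasure P A ^ m"
proof (induction m)
  case 0
  then show ?case by (simp add: emeasure_return_pmf)
next
  case (Suc m)
  have "emeasure (replicate_pmf (Suc m) P) {xs. set xs \<subseteq> A}
      = (\<integral>\<^sup>+x. emeasure (map_pmf (Cons x) (replicate_pmf m P)) {xs. set xs \<subseteq> A} \<partial>P)"
    by (simp add: emeasure_bind_pmf map_pmf_def)
  also have "\<dots> = (\<integral>\<^sup>+x. emeasure P A ^ m * indicator A x \<partial>P)"
  proof (rule nn_integral_cong)
    fix x
    have "Cons x -` {xs. set xs \<subseteq> A} = (if x \<in> A then {xs. set xs \<subseteq> A} else {})" by auto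
    then show "emeasure (map_pmf (Cons x) (replicate_pmf m P)) {xs. set xs \<subseteq> A} = emeasure P A ^ m * indicator A x"
      by (simp add: emeasure_map_pmf Suc.IH)
  qed
  also have "\<dots> = emeasure P A ^ Suc m" by (subst nn_integral_cmult_indicator) (auto simp: mult.commute)
  finally show ?case .
qed

lemma prob_replicate_pmf:
  "measure_pmf.prob (replicate_pmf m P) {xs. set xs \<subseteq> A} = measure_pmf.prob P A ^ m"
  using emeasure_replicate_pmf[of m P A]
  by (simp add: measure_pmf.emeasure_eq_measure ennreal_power)

text \<open>Only finitely many programs compete, since the selected one is no longer than
  \<open>h0\<close>. An inaccurate one is consistent with all samples with probability at most
  \<open>(1 - \<epsilon>) ^ m\<close>, whatever \<open>n\<close> is.\<close>

lemma mdl_pac_of_short_program: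
  fixes \<epsilon> \<delta> :: real
  assumes sel: "mdl_selector \<phi> sel" and P: "set_pmf P \<subseteq> {x. length x = n}"
    and h0: "length h0 \<le> l" "\<And>x. length x = n \<Longrightarrow> \<phi> h0 x = Some (f x)"
    and \<epsilon>: "0 < \<epsilon>" "\<epsilon> < 1"
    and m: "card {h :: bool list. length h \<le> l} * (1 - \<epsilon>) ^ m \<le> \<delta>"
  shows "mdl_pac \<phi> sel \<epsilon> \<delta> n f P m"
  unfolding mdl_pac_def
proof (intro allI impI)
  fix m' assume m': "m \<le> m'"
  let ?Q = "replicate_pmf m' P"
  let ?good = "{xs. acc P f (\<phi> (sel n (labelled f xs))) \<ge> 1 - \<epsilon>}"
  let ?L = "{h :: bool list. length h \<le> l}"
  define H where "H = {h \<in> ?L. acc P f (\<phi> h) < 1 - \<epsilon>}"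
  have finL: "finite ?L" using finite_lists_length_le[of "UNIV :: bool set" l] by simp
  then have finH: "finite H" by (simp add: H_def)
  define B where "B = (\<lambda>h. {xs. set xs \<subseteq> {x. \<phi> h x = Some (f x)}})"
  have "measure_pmf.prob ?Q (- ?good) \<le> measure_pmf.prob ?Q (\<Union>h\<in>H. B h)"
  proof (rule measure_pmf.finite_measure_mono_AE)
    \<comment> \<open>Almost surely only: \<open>h0\<close> is known to be right on strings of
      length \<open>n\<close>, which covers the support.\<close>
    show "AE xs in ?Q. xs \<in> - ?good \<longrightarrow> xs \<in> (\<Union>h\<in>H. B h)"
    proof (unfold AE_measure_pmf_iff, intro ballI impI)
      fix xs assume xs: "xs \<in> set_pmf ?Q" and bad: "xs \<in> - ?good"
      have len: "x \<in> set xs \<Longrightarrow> length x = n" for x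
        using xs P by (auto simp: set_replicate_pmf)
      let ?h = "sel n (labelled f xs)"
      have "h0 \<in> mdl_cands \<phi> n (labelled f xs)" using h0(2) len by (auto simp: mdl_cands_def labelled_def)
      then have "?h \<in> mdl_cands \<phi> n (labelled f xs)" "length ?h \<le> length h0"
        using sel unfolding mdl_selector_def by blast+
      then have "?h \<in> H" "xs \<in> B ?h"
        using bad h0(1) by (auto simp: H_def B_def mdl_cands_def labelled_def not_le)
      then show "xs \<in> (\<Union>h\<in>H. B h)" by blast
    qed
  qed simp
  also have "\<dots> \<le> (\<Sum>h\<in>H. measure_pmf.prob ?Q (B h))"
    by (rule measure_pmf.finite_measure_subadditive_finite) (auto simp: finH)
  also have "\<dots> \<le> (\<Sum>h\<in>H. (1 - \<epsilon>) ^ m)"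
  proof (rule sum_mono)
    fix h assume "h \<in> H"
    then have "measure_pmf.prob ?Q (B h) \<le> (1 - \<epsilon>) ^ m'"
      unfolding B_def prob_replicate_pmf by (intro power_mono) (auto simp: H_def acc_def)
    also have "\<dots> \<le> (1 - \<epsilon>) ^ m" using m' \<epsilon> by (intro power_decreasing) auto
    finally show "measure_pmf.prob ?Q (B h) \<le> (1 - \<epsilon>) ^ m" .
  qed
  also have "\<dots> \<le> card ?L * (1 - \<epsilon>) ^ m"
    using card_mono[OF finL, of H] \<epsilon> by (auto simp: H_def intro!: mult_right_mono)
  also have "\<dots> \<le> \<delta>" by (rule m)
  finally show "measure_pmf.prob ?Q ?good \<ge> 1 - \<delta>"
    using measure_pmf.prob_compl[of ?good ?Q] by (simp add: Compl_eq_Diff_UNIV)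
qed

text \<open>Of two encodings that begin the same string one is a prefix of the other, so
  prefix-freeness makes the machine, and then its argument, unique.\<close>

lemma univ_encoded:
  assumes "prefix_free_enc k E" "wf_tm k T"
  shows "univ k E (E T @ u) x = tm_out k T u x"
proof -
  have "(THE Tu. wf_tm k (fst Tu) \<and> E T @ u = E (fst Tu) @ snd Tu) = (T, u)"
  proof (rule the_equality)
    fix Tu assume Tu: "wf_tm k (fst Tu) \<and> E T @ u = E (fst Tu) @ snd Tu"
    then obtain v where "E T = E (fst Tu) @ v \<or> E (fst Tu) = E T @ v"
      by (metis append_eq_append_conv2)
    then have "fst Tu = T" using assms Tu unfolding prefix_free_enc_def by metis
    then show "Tu = (T, u)" using Tu by (metis prod.collapse same_append_eq)
  qed (use assms in simp)
  then show ?thesis using assms(2) by (auto simp: univ_def Let_def)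
qed

section \<open>Counting functions close to small circuits\<close>

text \<open>Generating function of the agreement count: each point contributes independently 1 for
  disagreement or \<open>r\<close> for agreement.\<close>

lemma sum_power_agreement:
  fixes r :: real
  assumes "finite S"
  shows "(\<Sum>A\<in>Pow S. r ^ card {x \<in> S. x \<in> A \<longleftrightarrow> x \<in> g}) = (1 + r) ^ card S"
  using assms
proof (induction S rule: finite_induct)
  case empty
  then show ?case by simp
next
  case (insert y S)
  define c where "c = (\<lambda>S A. card {x \<in> S. x \<in> A \<longleftrightarrow> x \<in> g})"
  have inj: "inj_on (insert y) (Pow S)" using insert(2) by (auto simp: inj_on_def)
  have sub: "A \<subseteq> S \<Longrightarrow> y \<notin> A" for A using insert(2) by auto
  have c1: "r ^ c (insert y S) A = (if y \<in> g then 1 else r) * r ^ c S A" if "A \<subseteq> S" for A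
  proof -
    have "{x \<in> insert y S. x \<in> A \<longleftrightarrow> x \<in> g} = (if y \<in> g then {} else {y}) \<union> {x \<in> S. x \<in> A \<longleftrightarrow> x \<in> g}"
      using sub[OF that] by auto
    then show ?thesis using insert(1,2) by (simp add: c_def)
  qed
  have c2: "r ^ c (insert y S) (insert y A) = (if y \<in> g then r else 1) * r ^ c S A" for A
  proof -
    have "{x \<in> insert y S. x \<in> insert y A \<longleftrightarrow> x \<in> g} = (if y \<in> g then {y} else {}) \<union> {x \<in> S. x \<in> A \<longleftrightarrow> x \<in> g}"
      using insert(2) by auto
    then show ?thesis using insert(1,2) by (simp add: c_def)
  qed
  have "(\<Sum>A\<in>Pow (insert y S). r ^ c (insert y S) A) =
     (\<Sum>A\<in>Pow S. r ^ c (insert y S) A) + (\<Sum>A\<in>insert y ` Pow S. r ^ c (insert y S) A)"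
    unfolding Pow_insert using insert(1,2) by (intro sum.union_disjoint) auto
  also have "(\<Sum>A\<in>insert y ` Pow S. r ^ c (insert y S) A) = (\<Sum>A\<in>Pow S. r ^ c (insert y S) (insert y A))"
    by (simp add: sum.reindex[OF inj])
  also have "(\<Sum>A\<in>Pow S. r ^ c (insert y S) A) = (\<Sum>A\<in>Pow S. (if y \<in> g then 1 else r) * r ^ c S A)"
    by (rule sum.cong) (auto simp: c1)
  also have "\<dots> + (\<Sum>A\<in>Pow S. r ^ c (insert y S) (insert y A)) = (1 + r) * (\<Sum>A\<in>Pow S. r ^ c S A)"
    unfolding c2 by (simp add: sum_distrib_left[symmetric] algebra_simps)
  finally show ?case using insert by (simp add: c_def)
qed

text \<open>Markov's inequality for the weight \<open>t\<close> to the power \<open>a\<close> times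
  the agreement; the integer \<open>a\<close> avoids fractional exponents.\<close>

lemma card_agreement_bound:
  fixes t :: real
  assumes "finite S" "t \<ge> 1"
  shows "card {A \<in> Pow S. b \<le> a * card {x \<in> S. x \<in> A \<longleftrightarrow> x \<in> g}} * t ^ b \<le> (1 + t ^ a) ^ card S"
proof -
  let ?B = "{A \<in> Pow S. b \<le> a * card {x \<in> S. x \<in> A \<longleftrightarrow> x \<in> g}}"
  have "card ?B * t ^ b = (\<Sum>A\<in>?B. t ^ b)" by simp
  also have "\<dots> \<le> (\<Sum>A\<in>?B. (t ^ a) ^ card {x \<in> S. x \<in> A \<longleftrightarrow> x \<in> g})"
    using assms(2) by (intro sum_mono) (auto simp: power_mult[symmetric] intro: power_increasing)
  also have "\<dots> \<le> (\<Sum>A\<in>Pow S. (t ^ a) ^ card {x \<in> S. x \<in> A \<longleftrightarrow> x \<in> g})"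
    using assms by (intro sum_mono2) auto
  also have "\<dots> = (1 + t ^ a) ^ card S" by (rule sum_power_agreement[OF assms(1)])
  finally show ?thesis .
qed

definition wire :: "nat \<Rightarrow> nat \<Rightarrow> nat \<Rightarrow> nat set" where
  "wire n W i = {x. x < 2 ^ n \<and> bt W (i * 2 ^ n + x)}"

text \<open>\<open>valid_wires\<close> leaves the bits beyond row \<open>n + s - 1\<close> free, so
  infinitely many \<open>W\<close> satisfy it; lists of rows can be counted.\<close>

definition wire_lists :: "nat \<Rightarrow> nat \<Rightarrow> nat set list set" where
  "wire_lists n s = (\<lambda>W. map (wire n W) [0..<n + s]) ` {W. valid_wires n s W}"

text \<open>The input rows are forced, and every further row is fixed by two earlier rows and one of
  16 connectives.\<close>

lemma card_wire_lists:
  "finite (wire_lists n s) \<and> card (wire_lists n s) \<le> (16 * (n + s) ^ 2) ^ s"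
proof (induction s)
  case 0
  have "map (wire n W) [0..<n] = map (\<lambda>j. {x. x < 2 ^ n \<and> bt x j}) [0..<n]" if "valid_wires n 0 W" for W
    using that by (auto simp: valid_wires_def wire_def)
  then have "wire_lists n 0 \<subseteq> {map (\<lambda>j. {x. x < 2 ^ n \<and> bt x j}) [0..<n]}"
    by (auto simp: wire_lists_def)
  from finite_subset[OF this] card_mono[OF _ this] show ?case by simp
next
  case (Suc s)
  define comb where "comb = (\<lambda>(ws, a, b, g). ws @ [{x. x < (2::nat) ^ n \<and>
     bt g (2 * of_bool (x \<in> ws ! a) + of_bool (x \<in> (ws ! b :: nat set)))}])"
  let ?X = "wire_lists n s \<times> {..<n + s} \<times> {..<n + s} \<times> {..<16::nat}"
  have sub: "wire_lists n (Suc s) \<subseteq> comb ` ?X"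
  proof
    fix ws assume "ws \<in> wire_lists n (Suc s)"
    then obtain W where W: "valid_wires n (Suc s) W" and ws: "ws = map (wire n W) [0..<n + Suc s]"
      by (auto simp: wire_lists_def)
    have "valid_wires n s W" using W by (auto simp: valid_wires_def)
    then have mem: "map (wire n W) [0..<n + s] \<in> wire_lists n s" by (auto simp: wire_lists_def)
    obtain a b g where abg: "a < n + s" "b < n + s" "g < 16"
      "\<forall>x<2 ^ n. bt W ((n + s) * 2 ^ n + x) = bt g (2 * of_bool (bt W (a * 2 ^ n + x)) + of_bool (bt W (b * 2 ^ n + x)))"
      using W unfolding valid_wires_def by blast
    have "wire n W (n + s) = {x. x < 2 ^ n \<and> bt g (2 * of_bool (x \<in> wire n W a) + of_bool (x \<in> wire n W b))}"
      unfolding wire_def by (intro Collect_cong conj_cong refl) (simp add: abg(4))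
    then have "ws = comb (map (wire n W) [0..<n + s], a, b, g)"
      using abg(1,2) by (simp add: ws comb_def)
    then show "ws \<in> comb ` ?X" using mem abg by blast
  qed
  have fin: "finite ?X" using Suc by simp
  have "card (wire_lists n (Suc s)) \<le> card ?X"
    using card_mono[OF finite_imageI[OF fin] sub] card_image_le[OF fin, of comb] by simp
  also have "\<dots> = card (wire_lists n s) * (16 * (n + s) ^ 2)"
    by (simp add: card_cartesian_product power2_eq_square)
  also have "\<dots> \<le> (16 * (n + s) ^ 2) ^ s * (16 * (n + s) ^ 2)" using Suc by simp
  also have "\<dots> = (16 * (n + s) ^ 2) ^ Suc s" by simp
  also have "\<dots> \<le> (16 * (n + Suc s) ^ 2) ^ Suc s" by (intro power_mono mult_le_mono2) auto
  finally show ?case using finite_subset[OF sub finite_imageI[OF fin]] by blast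
qed

text \<open>\<open>t\<close> is the exponential tilt in a Chernoff bound for the agreement of a random truth table with
  a fixed one.\<close>

lemma hard_exists_of_small_count:
  fixes t :: real
  assumes t: "t \<ge> 1" and n: "n \<ge> 1"
    and small: "(\<Sum>s | s < 2 ^ n \<and> s * M * n \<le> 2 ^ n. real ((16 * (n + s) ^ 2) ^ s)) * (1 + t ^ (2 * q)) ^ 2 ^ n
      < 2 ^ 2 ^ n * t ^ ((q + 2) * 2 ^ n)"
  shows "\<exists>F<2 ^ 2 ^ n. hard q M n F"
proof (rule ccontr)
  assume none: "\<not> (\<exists>F<2 ^ 2 ^ n. hard q M n F)"
  let ?N = "2 ^ n :: nat"
  let ?S = "{s. s < ?N \<and> s * M * n \<le> ?N}"
  define bad where "bad = (\<lambda>g. {A \<in> Pow {..<?N}. (q + 2) * ?N \<le> 2 * q * card {x \<in> {..<?N}. x \<in> A \<longleftrightarrow> x \<in> g}})"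
  let ?G = "\<lambda>s. last ` wire_lists n s"
  \<comment> \<open>Without a hard table, every subset agrees too much with the output row of some
    small wire table.\<close>
  have "Pow {..<?N} \<subseteq> (\<Union>s\<in>?S. \<Union>g\<in>?G s. bad g)"
  proof
    fix A assume A: "A \<in> Pow {..<?N}"
    then have "finite A" by (auto intro: finite_subset)
    have "set_encode A < 2 ^ ?N" using A by (intro set_encode_less) auto
    then have "\<not> hard q M n (set_encode A)" using none by blast
    then obtain s W where sW: "s < ?N" "s * M * n \<le> ?N" "valid_wires n s W" and
      big: "(q + 2) * ?N \<le> 2 * q * card {x. x < ?N \<and> bt (set_encode A) x = bt W ((n + s - 1) * ?N + x)}"
      unfolding hard_def by (auto simp: not_less)
    have eq: "{x. x < ?N \<and> bt (set_encode A) x = bt W ((n + s - 1) * ?N + x)}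
       = {x \<in> {..<?N}. x \<in> A \<longleftrightarrow> x \<in> wire n W (n + s - 1)}"
      using bt_set_encode[OF \<open>finite A\<close>] by (auto simp: wire_def)
    have "A \<in> bad (wire n W (n + s - 1))" using big A unfolding eq bad_def by blast
    moreover have "wire n W (n + s - 1) \<in> ?G s"
    proof -
      have "last (map (wire n W) [0..<n + s]) = wire n W (n + s - 1)"
        using n by (simp add: last_map)
      moreover have "map (wire n W) [0..<n + s] \<in> wire_lists n s" using sW by (auto simp: wire_lists_def)
      ultimately show ?thesis by force
    qed
    ultimately show "A \<in> (\<Union>s\<in>?S. \<Union>g\<in>?G s. bad g)" using sW(1,2) by blast
  qed
  moreover have finbad: "finite (bad g)" for g by (simp add: bad_def)
  moreover have finG: "finite (?G s)" for s using card_wire_lists by simp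
  ultimately have "card (Pow {..<?N}) \<le> card (\<Union>s\<in>?S. \<Union>g\<in>?G s. bad g)"
    by (intro card_mono finite_UN_I) auto
  also have "\<dots> \<le> (\<Sum>s\<in>?S. card (\<Union>g\<in>?G s. bad g))" by (rule card_UN_le) simp
  also have "\<dots> \<le> (\<Sum>s\<in>?S. \<Sum>g\<in>?G s. card (bad g))" by (intro sum_mono card_UN_le finG)
  finally have "real (2 ^ ?N) \<le> (\<Sum>s\<in>?S. \<Sum>g\<in>?G s. real (card (bad g)))"
    by (simp add: card_Pow flip: of_nat_sum of_nat_power_eq_of_nat_cancel_iff)
  then have "2 ^ ?N * t ^ ((q + 2) * ?N) \<le> (\<Sum>s\<in>?S. \<Sum>g\<in>?G s. real (card (bad g))) * t ^ ((q + 2) * ?N)"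
    using t by (intro mult_right_mono) auto
  also have "\<dots> = (\<Sum>s\<in>?S. \<Sum>g\<in>?G s. card (bad g) * t ^ ((q + 2) * ?N))"
    by (simp add: sum_distrib_right)
  also have "\<dots> \<le> (\<Sum>s\<in>?S. \<Sum>g\<in>?G s. (1 + t ^ (2 * q)) ^ ?N)"
  proof (intro sum_mono)
    fix g
    show "card (bad g) * t ^ ((q + 2) * ?N) \<le> (1 + t ^ (2 * q)) ^ ?N"
      using card_agreement_bound[of "{..<?N}" t "(q + 2) * ?N" "2 * q" g] t by (simp add: bad_def)
  qed
  also have "\<dots> \<le> (\<Sum>s\<in>?S. real ((16 * (n + s) ^ 2) ^ s) * (1 + t ^ (2 * q)) ^ ?N)"
  proof (rule sum_mono)
    fix s
    have "card (?G s) \<le> (16 * (n + s) ^ 2) ^ s"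
      using card_wire_lists[of n s] card_image_le[of "wire_lists n s" last] by linarith
    then have "real (card (?G s)) \<le> real ((16 * (n + s) ^ 2) ^ s)" by (rule of_nat_mono)
    then show "(\<Sum>g\<in>?G s. (1 + t ^ (2 * q)) ^ ?N) \<le> real ((16 * (n + s) ^ 2) ^ s) * (1 + t ^ (2 * q)) ^ ?N"
      using t unfolding sum_constant by (intro mult_right_mono) auto
  qed
  also have "\<dots> = (\<Sum>s\<in>?S. real ((16 * (n + s) ^ 2) ^ s)) * (1 + t ^ (2 * q)) ^ ?N"
    by (simp add: sum_distrib_right)
  finally show False using small by simp
qed

text \<open>At t = 1 both sides are 2, and the difference has slope 2(q + 2) - 2q = 4 there. The
  excess 1/q over 1/2 enters here: with q in place of q + 2 the slope would vanish.\<close>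

lemma ex_tilt:
  "\<exists>t>1::real. 1 + t ^ (2 * q) < 2 * t ^ (q + 2)"
proof -
  have "((\<lambda>t::real. 2 * t ^ (q + 2) - t ^ (2 * q)) has_real_derivative
      2 * (real (q + 2) * 1 ^ (q + 1)) - real (2 * q) * 1 ^ (2 * q - 1)) (at 1)"
    by (auto intro!: derivative_eq_intros)
  then have "DERIV (\<lambda>t::real. 2 * t ^ (q + 2) - t ^ (2 * q)) 1 :> 4" by simp
  from DERIV_pos_inc_right[OF this] obtain d :: real where d: "d > 0"
    "\<And>h. h > 0 \<Longrightarrow> h < d \<Longrightarrow> 2 * 1 ^ (q + 2) - 1 ^ (2 * q) < 2 * (1 + h) ^ (q + 2) - (1 + h) ^ (2 * q)" by auto
  from d(2)[of "d / 2"] d(1) show ?thesis by (intro exI[of _ "1 + d / 2"]) auto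
qed

lemma eventually_hard:
  "\<exists>M\<ge>1. \<exists>N. \<forall>n\<ge>N. \<exists>F<2 ^ 2 ^ n. hard q M n F"
proof -
  obtain t :: real where t: "t > 1" "1 + t ^ (2 * q) < 2 * t ^ (q + 2)" using ex_tilt by blast
  \<comment> \<open>Chernoff factor per input: at most a fraction \<open>\<rho> ^ 2 ^ n\<close> of
    the tables comes too close to a fixed one.\<close>
  define \<rho> where "\<rho> = (1 + t ^ (2 * q)) / (2 * t ^ (q + 2))"
  have \<rho>: "0 < \<rho>" "\<rho> < 1" using t by (auto simp: \<rho>_def add_pos_pos)
  \<comment> \<open>The midpoint of 1 and \<open>1 / \<rho>\<close>: even \<open>b ^ 2 ^ n\<close>
    circuits lose against the Chernoff factor.\<close>
  define b where "b = (1 + 1 / \<rho>) / 2"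
  have "b * \<rho> = (1 + \<rho>) / 2" "1 / \<rho> > 1" using \<rho> by (simp_all add: b_def field_simps)
  then have b: "b > 1" "0 < b * \<rho>" "b * \<rho> < 1" using \<rho> by (simp_all add: b_def)
  \<comment> \<open>256 is 2^8: below, each gate accounts for at most \<open>2 ^ (8 * n)\<close>
    choices.\<close>
  obtain M0 where M0: "256 < b ^ M0" using real_arch_pow[OF b(1), of 256] by blast
  define M where "M = max 1 M0"
  have M: "256 \<le> b ^ M"
  proof -
    have "b ^ M0 \<le> b ^ M" by (rule power_increasing) (use b(1) in \<open>auto simp: M_def\<close>)
    then show ?thesis using M0 by linarith
  qed
  \<comment> \<open>The factor \<open>N\<close> will bound the number of sizes \<open>s\<close>
    summed over.\<close>
  have "(\<lambda>N. real N * (b * \<rho>) ^ N) \<longlonglongrightarrow> 0"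
    by (rule powser_times_n_limit_0) (use b in simp)
  then have "eventually (\<lambda>N. real N * (b * \<rho>) ^ N < 1) sequentially"
    by (rule order_tendstoD) simp
  then obtain N0 where N0: "\<And>N. N \<ge> N0 \<Longrightarrow> real N * (b * \<rho>) ^ N < 1"
    by (auto simp: eventually_sequentially)
  have "\<exists>F<2 ^ 2 ^ n. hard q M n F" if n: "n \<ge> max 1 N0" for n
  proof (rule hard_exists_of_small_count)
    let ?N = "2 ^ n :: nat"
    let ?S = "{s. s < ?N \<and> s * M * n \<le> ?N}"
    have nN: "n < ?N" by (rule less_exp)
    have "real ((16 * (n + s) ^ 2) ^ s) \<le> b ^ ?N" if s: "s \<in> ?S" for s
    proof -
      have "s < ?N" using s by simp
      then have "n + s \<le> 2 * ?N" using nN by linarith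
      then have "n + s \<le> 2 ^ (n + 1)" by simp
      then have "16 * (n + s) ^ 2 \<le> 16 * (2 ^ (n + 1)) ^ 2" by (intro mult_le_mono2 power_mono) auto
      also have "\<dots> = 2 ^ (2 * n + 6)" by (simp add: power_mult[symmetric] power_add mult.commute)
      also have "\<dots> \<le> 2 ^ (8 * n)" using n by (intro power_increasing) auto
      finally have "(16 * (n + s) ^ 2) ^ s \<le> (2 ^ (8 * n)) ^ s" by (rule power_mono) simp
      then have "real ((16 * (n + s) ^ 2) ^ s) \<le> real ((2 ^ (8 * n)) ^ s)" by (rule of_nat_mono)
      also have "\<dots> = 256 ^ (n * s)" by (simp add: power_mult)
      also have "\<dots> \<le> (b ^ M) ^ (n * s)" using M by (intro power_mono) auto
      also have "\<dots> = b ^ (s * M * n)" by (simp add: power_mult[symmetric] mult.commute mult.left_commute)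
      also have "\<dots> \<le> b ^ ?N" using b s by (intro power_increasing) auto
      finally show ?thesis .
    qed
    then have "(\<Sum>s\<in>?S. real ((16 * (n + s) ^ 2) ^ s)) \<le> card ?S * b ^ ?N"
      by (rule sum_bounded_above)
    also have "\<dots> \<le> real ?N * b ^ ?N"
    proof (rule mult_right_mono)
      have "card ?S \<le> card {..<?N}" by (rule card_mono) auto
      then show "real (card ?S) \<le> real ?N" by simp
    qed (use b in simp)
    finally have "(\<Sum>s\<in>?S. real ((16 * (n + s) ^ 2) ^ s)) * (1 + t ^ (2 * q)) ^ ?N
       \<le> real ?N * b ^ ?N * (1 + t ^ (2 * q)) ^ ?N"
      using t by (intro mult_right_mono) auto
    also have "\<dots> = (real ?N * (b * \<rho>) ^ ?N) * (2 ^ ?N * t ^ ((q + 2) * ?N))"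
    proof -
      have \<rho>_eq: "1 + t ^ (2 * q) = \<rho> * (2 * t ^ (q + 2))" using t by (simp add: \<rho>_def)
      show ?thesis unfolding \<rho>_eq by (simp only: power_mult_distrib power_mult mult_ac)
    qed
    also have "\<dots> < 1 * (2 ^ ?N * t ^ ((q + 2) * ?N))"
    proof (rule mult_strict_right_mono)
      have "N0 \<le> ?N" using nN n by linarith
      then show "real ?N * (b * \<rho>) ^ ?N < 1" by (rule N0)
    qed (use t in simp)
    finally show "(\<Sum>s\<in>?S. real ((16 * (n + s) ^ 2) ^ s)) * (1 + t ^ (2 * q)) ^ ?N < 2 ^ ?N * t ^ ((q + 2) * ?N)"
      by (simp only: mult_1)
  qed (use t n in auto)
  then show ?thesis by (intro exI[of _ M] conjI exI[of _ "max 1 N0"]) (auto simp: M_def)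
qed

lemma hard_fun_eq:
  assumes "\<exists>F<2 ^ 2 ^ n. hard q M n F"
  shows "\<exists>F. hard q M n F \<and> (\<forall>v. hard_fun q M n v = bt F v)"
proof -
  define F where "F = (LEAST F. F < 2 ^ 2 ^ n \<and> hard q M n F)"
  have F: "F < 2 ^ 2 ^ n" "hard q M n F" using LeastI_ex[OF assms] by (auto simp: F_def)
  have min: "\<not> hard q M n G" if "G < F" for G
    using not_less_Least[of G "\<lambda>F. F < 2 ^ 2 ^ n \<and> hard q M n F"] that F(1) by (auto simp: F_def)
  have "G = F" if "hard q M n G" "\<forall>G'<G. \<not> hard q M n G'" for G
    using that min F(2) by (metis linorder_neqE_nat)
  then have "hard_fun q M n v = bt F v" for v unfolding hard_fun_def using F min by blast
  then show ?thesis using F by blast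
qed

section \<open>The lower bound\<close>

definition cube_pmf :: "nat \<Rightarrow> bool list pmf" where
  "cube_pmf n = pmf_of_set {x. length x = n}"

lemma finite_cube: "finite {x :: bool list. length x = n}"
  using finite_lists_length_eq[of "UNIV :: bool set" n] by simp

lemma cube_nonempty: "{x :: bool list. length x = n} \<noteq> {}"
  by (metis (mono_tags) empty_iff length_replicate mem_Collect_eq)

lemma set_cube_pmf: "set_pmf (cube_pmf n) = {x. length x = n}"
  unfolding cube_pmf_def by (rule set_pmf_of_set[OF cube_nonempty finite_cube])

lemma acc_cube:
  assumes "\<And>x. length x = n \<Longrightarrow> g x = Some (b (bits_nat x))" "\<And>x. length x = n \<Longrightarrow> f x = a (bits_nat x)"
  shows "acc (cube_pmf n) f g = card {v. v < 2 ^ n \<and> a v = b v} / 2 ^ n"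
proof -
  have "bij_betw bits_nat ({x. length x = n} \<inter> {x. g x = Some (f x)}) {v. v < 2 ^ n \<and> a v = b v}"
  proof (rule bij_betw_subset[OF bij_betw_bits_nat[of n]])
    show "bits_nat ` ({x. length x = n} \<inter> {x. g x = Some (f x)}) = {v. v < 2 ^ n \<and> a v = b v}"
    proof (intro set_eqI iffI)
      fix v assume "v \<in> {v. v < 2 ^ n \<and> a v = b v}"
      then have "v = bits_nat (nat_bits n v)" "nat_bits n v \<in> {x. length x = n} \<inter> {x. g x = Some (f x)}"
        using assms by auto
      then show "v \<in> bits_nat ` ({x. length x = n} \<inter> {x. g x = Some (f x)})" by blast
    qed (use assms bits_nat_less in auto)
  qed auto
  moreover have "card {x :: bool list. length x = n} = 2 ^ n"
    using bij_betw_same_card[OF bij_betw_bits_nat[of n]] by simp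
  ultimately show ?thesis
    unfolding acc_def cube_pmf_def measure_pmf_of_set[OF cube_nonempty finite_cube]
    by (simp add: bij_betw_same_card)
qed

lemma mdl_circ_not_pac:
  assumes sel: "mdl_selector circ_interp sel" and hard: "hard q M n F"
    and f: "\<And>x. length x = n \<Longrightarrow> f x = bt F (bits_nat x)"
    and M: "M \<ge> 1" and n: "n \<ge> 2" and m: "m \<ge> 1" "10 * m * M * n \<le> 2 ^ n"
    and q: "q \<ge> 1" "(real q + 2) / (2 * real q) \<le> 1 - \<epsilon>" and \<delta>: "\<delta> < 1"
  shows "\<not> mdl_pac circ_interp sel \<epsilon> \<delta> n f (cube_pmf n) m"
proof -
  let ?good = "{xs. acc (cube_pmf n) f (circ_interp (sel n (labelled f xs))) \<ge> 1 - \<epsilon>}"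
  have "xs \<notin> ?good" if xs: "xs \<in> set_pmf (replicate_pmf m (cube_pmf n))" for xs
  proof -
    have len: "length xs = m" "\<And>x. x \<in> set xs \<Longrightarrow> length x = n"
      using xs by (auto simp: set_replicate_pmf set_cube_pmf)
    then have "xs \<noteq> []" using m by auto
    from mdl_circ_selected[OF sel _ this len(2), of f] n obtain gs where gs: "valid_circ n gs" "length gs \<le> 10 * m"
      "\<And>x. length x = n \<Longrightarrow> circ_interp (sel n (labelled f xs)) x = Some (circ_eval gs x)"
      using len(1) by auto
    from circ_wires[OF gs(1)] obtain W where W: "W < 2 ^ ((n + length gs) * 2 ^ n)" "valid_wires n (length gs) W"
      "\<And>x. length x = n \<Longrightarrow> bt W ((n + length gs - 1) * 2 ^ n + bits_nat x) = circ_eval gs x" by blast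
    let ?g = "\<lambda>v. bt W ((n + length gs - 1) * 2 ^ n + v)"
    have small: "length gs * M * n \<le> 2 ^ n"
    proof -
      have "length gs * M * n \<le> 10 * m * M * n" using gs(2) by (intro mult_le_mono1)
      then show ?thesis using m(2) by linarith
    qed
    \<comment> \<open>\<open>hard\<close> also asks for this bound; it follows from
      \<open>2 \<le> M * n\<close>, which is why \<open>n \<ge> 2\<close> is assumed.\<close>
    have "length gs < 2 ^ n"
    proof (cases "length gs = 0")
      case False
      have "2 \<le> M * n" using mult_le_mono[OF M n] by simp
      then have "length gs * 2 \<le> length gs * (M * n)" by (intro mult_le_mono2)
      also have "\<dots> \<le> 2 ^ n" using small by (simp only: mult.assoc)
      finally show ?thesis using False by linarith
    qed simp
    then have "2 * q * card {v. v < 2 ^ n \<and> bt F v = ?g v} < (q + 2) * 2 ^ n"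
      using hard small W(1,2) unfolding hard_def by blast
    then have "real (2 * q * card {v. v < 2 ^ n \<and> bt F v = ?g v}) < real ((q + 2) * 2 ^ n)"
      by (rule of_nat_less_iff[THEN iffD2])
    then have "card {v. v < 2 ^ n \<and> bt F v = ?g v} / 2 ^ n < (real q + 2) / (2 * real q)"
      using q(1) by (simp add: field_simps)
    moreover have "acc (cube_pmf n) f (circ_interp (sel n (labelled f xs))) = card {v. v < 2 ^ n \<and> bt F v = ?g v} / 2 ^ n"
      by (rule acc_cube) (use gs(3) W(3) f in auto)
    ultimately show ?thesis using q(2) by simp
  qed
  then have "measure_pmf.prob (replicate_pmf m (cube_pmf n)) ?good = 0"
    unfolding measure_pmf_zero_iff by blast
  \<comment> \<open>Taking \<open>m' = m\<close> refutes the property: success has probability 0,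
    below 1 - \<delta>.\<close>
  then show ?thesis using \<delta> unfolding mdl_pac_def by force
qed

theorem theorem2:
  fixes \<epsilon> \<delta> :: real and d k :: nat and E :: "tm \<Rightarrow> bool list"
    and selU selC :: "nat \<Rightarrow> (bool list \<times> bool) list \<Rightarrow> bool list"
  assumes "0 < \<epsilon>" "\<epsilon> < 1/2" "0 < \<delta>" "\<delta> < 1" "d \<ge> 1"
    and "k \<ge> 1" "prefix_free_enc k E"
    and "mdl_selector (univ k E) selU" "mdl_selector circ_interp selC"
  shows "\<exists>c > 0. \<exists>N. \<forall>n \<ge> N.
           gain (univ k E) selU circ_interp selC d \<epsilon> \<delta> n \<ge> ereal (c * 2 ^ n / real n)"
proof -
  \<comment> \<open>The fraction equals 1/2 + 1/q, so it suffices that 1/q is below the gap 1/2 -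
    \<epsilon>.\<close>
  obtain q :: nat where q: "q \<ge> 1" "(real q + 2) / (2 * real q) \<le> 1 - \<epsilon>"
  proof -
    obtain q :: nat where q: "1 / (1/2 - \<epsilon>) < real q" using reals_Archimedean2 by blast
    have "0 < 1 / (1/2 - \<epsilon>)" using assms(2) by simp
    then have pos: "0 < real q" using q by linarith
    have "1 < real q * (1/2 - \<epsilon>)" using q assms(2) by (simp add: pos_divide_less_eq)
    then have "1 / real q < 1/2 - \<epsilon>" using pos by (simp add: divide_less_eq mult.commute)
    moreover have "(real q + 2) / (2 * real q) = 1/2 + 1 / real q" using pos by (simp add: field_simps)
    ultimately have "(real q + 2) / (2 * real q) \<le> 1 - \<epsilon>" by linarith
    moreover have "q \<ge> 1" using pos by simp
    ultimately show thesis using that by blast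
  qed
  obtain M N0 where M: "M \<ge> 1" and N0: "\<And>n. n \<ge> N0 \<Longrightarrow> \<exists>F<2 ^ 2 ^ n. hard q M n F"
    using eventually_hard[of q] by blast
  obtain T where T: "wf_tm k T" "\<And>x. tm_out k T [True] x = Some (hard_fun q M (length x) (bits_nat x))"
    using hard_fun_tm[OF assms(6), of q M] by blast
  define f where "f = (\<lambda>x. hard_fun q M (length x) (bits_nat x))"
  \<comment> \<open>The argument \<open>[True]\<close> is the origin mark on which the compiled
    machine relies.\<close>
  define h0 where "h0 = E T @ [True]"
  have h0: "univ k E h0 x = Some (f x)" for x
    unfolding h0_def univ_encoded[OF assms(7) T(1)] T(2) f_def ..
  define l where "l = length h0"
  define L where "L = real (card {h :: bool list. length h \<le> l})"
  have "(\<lambda>m. L * (1 - \<epsilon>) ^ m) \<longlonglongrightarrow> L * 0"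
    using assms by (intro tendsto_mult tendsto_const LIMSEQ_power_zero) auto
  then have "eventually (\<lambda>m. L * (1 - \<epsilon>) ^ m < \<delta>) sequentially"
    using assms(3) by (intro order_tendstoD) simp_all
  then have "eventually (\<lambda>m. L * (1 - \<epsilon>) ^ m < \<delta> \<and> m \<ge> 1) sequentially"
    using eventually_ge_at_top[of 1] by (rule eventually_conj)
  then obtain m0 where m0: "L * (1 - \<epsilon>) ^ m0 < \<delta>" "m0 \<ge> 1"
    by (auto simp: eventually_sequentially)
  \<comment> \<open>10 comes from memorising, \<open>M\<close> from counting, and \<open>m0\<close>
    is the sample bound on the universal side; \<open>l\<close>, \<open>L\<close> and
    \<open>m0\<close> are fixed before \<open>n\<close>.\<close>
  define c where "c = 1 / (10 * real M * real m0)"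
  have "c > 0" using M m0 by (simp add: c_def)
  \<comment> \<open>\<open>n \<ge> l\<close> puts the constant description length below
    \<open>n ^ d\<close>.\<close>
  moreover have "gain (univ k E) selU circ_interp selC d \<epsilon> \<delta> n \<ge> ereal (c * 2 ^ n / real n)"
    if n: "n \<ge> max (max 2 N0) l" for n
  proof -
    let ?P = "cube_pmf n"
    let ?a = "mdl_samples circ_interp selC \<epsilon> \<delta> n f ?P"
    let ?b = "mdl_samples (univ k E) selU \<epsilon> \<delta> n f ?P"
    have desc: "desc_len (univ k E) n f \<le> enat (n ^ d)"
    proof -
      have "(LEAST l. \<exists>h. length h = l \<and> (\<forall>x. length x = n \<longrightarrow> univ k E h x = Some (f x))) \<le> l"
        by (rule Least_le) (use h0 l_def in blast)
      also have "l \<le> n ^ 1" using n by simp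
      also have "\<dots> \<le> n ^ d" using n assms(5) by (intro power_increasing) auto
      finally show ?thesis using h0 unfolding desc_len_def by auto
    qed
    have "mdl_pac (univ k E) selU \<epsilon> \<delta> n f ?P m0"
      by (rule mdl_pac_of_short_program[OF assms(8), of _ _ h0 l])
         (use h0 m0 assms in \<open>auto simp: set_cube_pmf l_def L_def\<close>)
    then have ex: "\<exists>m\<ge>1. mdl_pac (univ k E) selU \<epsilon> \<delta> n f ?P m" using m0(2) by blast
    define b where "b = (LEAST m. m \<ge> 1 \<and> mdl_pac (univ k E) selU \<epsilon> \<delta> n f ?P m)"
    have b: "?b = enat b" "b \<ge> 1" "b \<le> m0"
    proof -
      show "?b = enat b" using ex by (simp add: mdl_samples_def b_def)
      show "b \<ge> 1" using LeastI_ex[OF ex[unfolded Bex_def]] unfolding b_def by blast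
      show "b \<le> m0" unfolding b_def by (rule Least_le) (use m0(2) \<open>mdl_pac _ _ _ _ _ _ _ m0\<close> in blast)
    qed
    obtain F where F: "hard q M n F" "\<And>v. hard_fun q M n v = bt F v"
      using hard_fun_eq[OF N0[of n]] n by auto
    have npac: "\<not> mdl_pac circ_interp selC \<epsilon> \<delta> n f ?P m" if "m \<ge> 1" "10 * m * M * n \<le> 2 ^ n" for m
      by (rule mdl_circ_not_pac[OF assms(9) F(1) _ M _ that q assms(4)]) (use n F(2) in \<open>auto simp: f_def\<close>)
    \<comment> \<open>If some sample size works, the least one must violate the size condition of
      \<open>npac\<close>; otherwise the numerator is infinite.\<close>
    have a: "ereal (2 ^ n / (10 * real M * real n)) \<le> ereal_of_enat ?a"
    proof (cases "\<exists>m\<ge>1. mdl_pac circ_interp selC \<epsilon> \<delta> n f ?P m")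
      case True
      define a where "a = (LEAST m. m \<ge> 1 \<and> mdl_pac circ_interp selC \<epsilon> \<delta> n f ?P m)"
      have "a \<ge> 1 \<and> mdl_pac circ_interp selC \<epsilon> \<delta> n f ?P a"
        unfolding a_def by (rule LeastI_ex) (use True in blast)
      then have "\<not> 10 * a * M * n \<le> 2 ^ n" using npac by blast
      then have "2 ^ n < 10 * a * M * n" by simp
      then have "real (2 ^ n) < real (10 * a * M * n)" by (rule of_nat_less_iff[THEN iffD2])
      then have "2 ^ n / (10 * real M * real n) \<le> real a" using M n by (simp add: divide_le_eq mult_ac)
      moreover have "?a = enat a" using True by (simp add: mdl_samples_def a_def)
      ultimately show ?thesis by simp
    next
      case False
      then have "?a = \<infinity>" unfolding mdl_samples_def by (simp only: if_False)
      then show ?thesis by simp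
    qed
    have "ereal (c * 2 ^ n / real n) = ereal (2 ^ n / (10 * real M * real n)) / ereal (real m0)"
      using m0(2) by (simp add: c_def)
    also have "\<dots> \<le> ereal_of_enat ?a / ereal (real m0)"
      using a m0(2) by (intro ereal_divide_right_mono) auto
    also have "\<dots> \<le> ereal_of_enat ?a / ereal (real b)"
    proof (rule ereal_divide_left_mono)
      have "0 < ereal (2 ^ n / (10 * real M * real n))" using M n by simp
      then show "0 < ereal_of_enat ?a" using a by (rule less_le_trans)
    qed (use b m0(2) in auto)
    also have "\<dots> = ereal_of_enat ?a / ereal_of_enat ?b" using b(1) by simp
    also have "\<dots> \<le> gain (univ k E) selU circ_interp selC d \<epsilon> \<delta> n"
      unfolding gain_def by (rule Sup_upper) (use desc set_cube_pmf in blast)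
    finally show ?thesis .
  qed
  ultimately show ?thesis by blast
qed

end
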